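(* Let $\Omega$ be a slice domain in $\mathbb{H}$ and let $f:\Omega\to\mathbb{H}$ be a slice regular function. Fix $p=x_0+y_0I_0\in\Omega$ (with $x_0,y_0\in\mathbb{R}$, $y_0>0$, $I_0\in\mathbb{S}$), let $S=x_0+y_0\mathbb{S}$, set $$\mathcal{O}(p)=\{q\in S\cap\Omega: f^\circ_s(q)\neq-\operatorname{Im}(p)f'_s(q)\},$$ and consider the slice domain $\Omega'=\Omega\setminus\mathcal{O}(p)$. Then there exists a slice regular function $g:\Omega'\to\mathbb{H}$ such that $$f(q)=(q-p)*g(q)$$ throughout $\Omega'$. Moreover, for any slice domain $\Lambda\subseteq\Omega$ that intersects $\mathcal{O}(p)$, there cannot exist a slice regular $g:\Lambda\to\mathbb{H}$ such that the previous equality holds in $\Lambda$.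
   Context: $\mathbb{H}$ is the real algebra of quaternions, $\mathbb{S}=\{J\in\mathbb{H}:J^2=-1\}$, $x+y\mathbb{S}=\{x+yJ:J\in\mathbb{S}\}$, $L_I=\mathbb{R}+I\mathbb{R}$ and $T_I=T\cap L_I$ for $I\in\mathbb{S}$, $T\subseteq\mathbb{H}$. For $q=x+yI$ ($x,y\in\mathbb{R}$, $I\in\mathbb{S}$), $\operatorname{Im}(q)=yI$. A domain is a nonempty open connected set; a slice domain is a domain $\Omega\subseteq\mathbb{H}$ with $\Omega\cap\mathbb{R}\neq\emptyset$ such that $\Omega_I$ is a domain of $L_I$ for every $I\in\mathbb{S}$. A function $f:\Omega\to\mathbb{H}$ is slice regular if, for every $I\in\mathbb{S}$, the restriction $f_I$ of $f$ to $\Omega_I$ has continuous partial derivatives and $\frac12\left(\frac{\partial}{\partial x}+I\frac{\partial}{\partial y}\right)f_I(x+yI)\equiv0$. Spherical value and derivative: for a slice regular $f$ on a slice domain $\Omega$ and $p_0=x_0+y_0I_0\in\Omega\setminus\mathbb{R}$ ($y_0>0$, $I_0\in\mathbb{S}$), it is known that there exist a neighborhood $U\subseteq\Omega$ of $p_0$ in $x_0+y_0\mathbb{S}$ and unique quaternions $b(p_0),c(p_0)$ (independent of $U$) with $f(x_0+y_0I)=b(p_0)+I\,c(p_0)$ for all $x_0+y_0I\in U$. Set $f^\circ_s(p_0)=b(p_0)$ and $f'_s(p_0)=y_0^{-1}c(p_0)$; for $p_0\in\Omega\cap\mathbb{R}$ set $f^\circ_s(p_0)=f(p_0)$. Regular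 product: for $q\in\Omega\setminus\mathbb{R}$, $(f*g)(q)=f^\circ_s(q)g^\circ_s(q)+\operatorname{Im}(q)^2f'_s(q)g'_s(q)+\operatorname{Im}(q)\big(f^\circ_s(q)g'_s(q)+f'_s(q)g^\circ_s(q)\big)$, and $(f*g)(q)=f(q)g(q)$ for $q\in\Omega\cap\mathbb{R}$. The expression $(q-p)*g(q)$ means the regular product of the function $q\mapsto q-p$ and $g$, evaluated at $q$. *)

theory Defs
  imports "HOL-Analysis.Analysis"
begin

section \<open>The real algebra of quaternions\<close>

datatype quat = Quat (q_re: real) (q_i: real) (q_j: real) (q_k: real)

lemma quat_eq_iff:
  "p = q \<longleftrightarrow> q_re p = q_re q \<and> q_i p = q_i q \<and> q_j p = q_j q \<and> q_k p = q_k q"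
  by (cases p; cases q) simp

instantiation quat :: ring_1
begin

definition zero_quat :: quat where "0 = Quat 0 0 0 0"
definition one_quat :: quat where "1 = Quat 1 0 0 0"
definition plus_quat :: "quat \<Rightarrow> quat \<Rightarrow> quat" where
  "p + q = Quat (q_re p + q_re q) (q_i p + q_i q) (q_j p + q_j q) (q_k p + q_k q)"
definition uminus_quat :: "quat \<Rightarrow> quat" where
  "- p = Quat (- q_re p) (- q_i p) (- q_j p) (- q_k p)"
definition minus_quat :: "quat \<Rightarrow> quat \<Rightarrow> quat" where
  "p - q = Quat (q_re p - q_re q) (q_i p - q_i q) (q_j p - q_j q) (q_k p - q_k q)"
definition times_quat :: "quat \<Rightarrow> quat \<Rightarrow> quat" where
  "p * q = Quat
     (q_re p * q_re q - q_i p * q_i q - q_j p * q_j q - q_k p * q_k q)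
     (q_re p * q_i q + q_i p * q_re q + q_j p * q_k q - q_k p * q_j q)
     (q_re p * q_j q - q_i p * q_k q + q_j p * q_re q + q_k p * q_i q)
     (q_re p * q_k q + q_i p * q_j q - q_j p * q_i q + q_k p * q_re q)"

instance
  by standard
    (simp_all add: quat_eq_iff zero_quat_def one_quat_def plus_quat_def uminus_quat_def
      minus_quat_def times_quat_def algebra_simps)

end

instantiation quat :: real_algebra_1
begin

definition scaleR_quat :: "real \<Rightarrow> quat \<Rightarrow> quat" where
  "r *\<^sub>R q = Quat (r * q_re q) (r * q_i q) (r * q_j q) (r * q_k q)"

instance
  by standard
    (simp_all add: quat_eq_iff scaleR_quat_def plus_quat_def times_quat_def one_quat_def algebra_simps)

end

lemma quat_sel [simp]:
  "q_re 0 = 0" "q_i 0 = 0" "q_j 0 = 0" "q_k 0 = 0"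
  "q_re 1 = 1" "q_i 1 = 0" "q_j 1 = 0" "q_k 1 = 0"
  "q_re (p + q) = q_re p + q_re q" "q_i (p + q) = q_i p + q_i q"
  "q_j (p + q) = q_j p + q_j q" "q_k (p + q) = q_k p + q_k q"
  "q_re (- p) = - q_re p" "q_i (- p) = - q_i p" "q_j (- p) = - q_j p" "q_k (- p) = - q_k p"
  "q_re (p - q) = q_re p - q_re q" "q_i (p - q) = q_i p - q_i q"
  "q_j (p - q) = q_j p - q_j q" "q_k (p - q) = q_k p - q_k q"
  "q_re (p * q) = q_re p * q_re q - q_i p * q_i q - q_j p * q_j q - q_k p * q_k q"
  "q_i (p * q) = q_re p * q_i q + q_i p * q_re q + q_j p * q_k q - q_k p * q_j q"
  "q_j (p * q) = q_re p * q_j q - q_i p * q_k q + q_j p * q_re q + q_k p * q_i q"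
  "q_k (p * q) = q_re p * q_k q + q_i p * q_j q - q_j p * q_i q + q_k p * q_re q"
  "q_re (r *\<^sub>R q) = r * q_re q" "q_i (r *\<^sub>R q) = r * q_i q"
  "q_j (r *\<^sub>R q) = r * q_j q" "q_k (r *\<^sub>R q) = r * q_k q"
  by (simp_all add: zero_quat_def one_quat_def plus_quat_def uminus_quat_def
      minus_quat_def times_quat_def scaleR_quat_def)

lemma quat_sel_of_real [simp]:
  "q_re (of_real x) = x" "q_i (of_real x) = 0" "q_j (of_real x) = 0" "q_k (of_real x) = 0"
  by (simp_all add: of_real_def)

instantiation quat :: division_ring
begin

definition inverse_quat :: "quat \<Rightarrow> quat" where
  "inverse q = (1 / ((q_re q)\<^sup>2 + (q_i q)\<^sup>2 + (q_j q)\<^sup>2 + (q_k q)\<^sup>2)) *\<^sub>R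
     Quat (q_re q) (- q_i q) (- q_j q) (- q_k q)"
definition divide_quat :: "quat \<Rightarrow> quat \<Rightarrow> quat" where
  "p div q = p * inverse (q :: quat)"

instance
proof
  fix q :: quat
  assume "q \<noteq> 0"
  define n where "n = (q_re q)\<^sup>2 + (q_i q)\<^sup>2 + (q_j q)\<^sup>2 + (q_k q)\<^sup>2"
  have n: "n \<noteq> 0"
    using \<open>q \<noteq> 0\<close> by (auto simp: n_def quat_eq_iff add_nonneg_eq_0_iff)
  let ?c = "Quat (q_re q) (- q_i q) (- q_j q) (- q_k q)"
  have "?c * q = n *\<^sub>R 1" "q * ?c = n *\<^sub>R 1"
    by (simp_all add: quat_eq_iff n_def power2_eq_square)
  then show "inverse q * q = 1" "q * inverse q = 1"
    using n by (simp_all add: inverse_quat_def flip: n_def)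
qed (simp_all add: divide_quat_def inverse_quat_def quat_eq_iff)

end

instantiation quat :: real_inner
begin

definition inner_quat :: "quat \<Rightarrow> quat \<Rightarrow> real" where
  "p \<bullet> q = q_re p * q_re q + q_i p * q_i q + q_j p * q_j q + q_k p * q_k q"
definition norm_quat :: "quat \<Rightarrow> real" where
  "norm q = sqrt ((q_re q)\<^sup>2 + (q_i q)\<^sup>2 + (q_j q)\<^sup>2 + (q_k q)\<^sup>2)"
definition sgn_quat :: "quat \<Rightarrow> quat" where
  "sgn (q :: quat) = q /\<^sub>R norm q"
definition dist_quat :: "quat \<Rightarrow> quat \<Rightarrow> real" where
  "dist p (q :: quat) = norm (p - q)"
definition uniformity_quat :: "(quat \<times> quat) filter" where
  "uniformity = (INF e\<in>{0 <..}. principal {(x :: quat, y). dist x y < e})"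
definition open_quat :: "quat set \<Rightarrow> bool" where
  "open (U :: quat set) \<longleftrightarrow> (\<forall>x\<in>U. eventually (\<lambda>(x', y). x' = x \<longrightarrow> y \<in> U) uniformity)"

instance
proof
  fix p q s :: quat and r :: real and U :: "quat set"
  show "dist p q = norm (p - q)" by (rule dist_quat_def)
  show "sgn q = q /\<^sub>R norm q" by (rule sgn_quat_def)
  show "uniformity = (INF e\<in>{0 <..}. principal {(x :: quat, y). dist x y < e})"
    by (rule uniformity_quat_def)
  show "open (U :: quat set) \<longleftrightarrow> (\<forall>x\<in>U. eventually (\<lambda>(x', y). x' = x \<longrightarrow> y \<in> U) uniformity)"
    by (rule open_quat_def)
  show "p \<bullet> q = q \<bullet> p" "(p + q) \<bullet> s = p \<bullet> s + q \<bullet> s" "(r *\<^sub>R p) \<bullet> q = r * (p \<bullet> q)"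
    by (simp_all add: inner_quat_def algebra_simps)
  show "0 \<le> p \<bullet> p" by (simp add: inner_quat_def)
  show "p \<bullet> p = 0 \<longleftrightarrow> p = 0"
    by (simp add: inner_quat_def quat_eq_iff add_nonneg_eq_0_iff)
  show "norm p = sqrt (p \<bullet> p)"
    by (simp add: norm_quat_def inner_quat_def power2_eq_square)
qed

end

instance quat :: real_normed_div_algebra
proof
  fix p q :: quat
  show "norm (p * q) = norm p * norm q"
    unfolding norm_quat_def real_sqrt_mult [symmetric]
    by (rule arg_cong [where f = sqrt], unfold quat_sel) algebra
qed

instantiation quat :: euclidean_space
begin

definition Basis_quat :: "quat set" where
  "Basis = {Quat 1 0 0 0, Quat 0 1 0 0, Quat 0 0 1 0, Quat 0 0 0 1}"

instance
proof
  fix q :: quat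
  show "(\<forall>u\<in>Basis. q \<bullet> u = 0) \<longleftrightarrow> q = 0"
    by (simp add: Basis_quat_def inner_quat_def) (simp add: quat_eq_iff)
qed (auto simp: Basis_quat_def inner_quat_def)

end

section \<open>Slice domains and slice regular functions\<close>

definition q_Im :: "quat \<Rightarrow> quat" where
  "q_Im q = q - of_real (q_re q)"

definition imag_units :: "quat set" where
  "imag_units = {J. J\<^sup>2 = - 1}"

definition qpt :: "real \<Rightarrow> real \<Rightarrow> quat \<Rightarrow> quat" where
  "qpt x y J = of_real x + of_real y * J"

definition qsphere :: "real \<Rightarrow> real \<Rightarrow> quat set" where
  "qsphere x y = {qpt x y J | J. J \<in> imag_units}"

definition slice_plane :: "quat \<Rightarrow> quat set" where
  "slice_plane J = {qpt x y J | x y. True}"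

definition slice_domain :: "quat set \<Rightarrow> bool" where
  "slice_domain \<Omega> \<longleftrightarrow>
     \<Omega> \<noteq> {} \<and> open \<Omega> \<and> connected \<Omega> \<and> \<Omega> \<inter> \<real> \<noteq> {} \<and>
     (\<forall>J\<in>imag_units.
        \<Omega> \<inter> slice_plane J \<noteq> {} \<and>
        openin (top_of_set (slice_plane J)) (\<Omega> \<inter> slice_plane J) \<and>
        connected (\<Omega> \<inter> slice_plane J))"

text \<open>
  Functions on \<open>\<Omega>\<close> are represented by total functions whose values outside \<open>\<Omega>\<close> are irrelevant:
  the definition is applied to open \<open>\<Omega>\<close> only. The functions \<open>fx\<close> and \<open>fy\<close> are the partial
  derivatives of the restriction of \<open>f\<close> to \<open>\<Omega> \<inter> slice_plane J\<close>.
\<close>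
definition slice_regular :: "quat set \<Rightarrow> (quat \<Rightarrow> quat) \<Rightarrow> bool" where
  "slice_regular \<Omega> f \<longleftrightarrow>
     (\<forall>J\<in>imag_units. \<exists>fx fy.
        continuous_on (\<Omega> \<inter> slice_plane J) fx \<and>
        continuous_on (\<Omega> \<inter> slice_plane J) fy \<and>
        (\<forall>x y. qpt x y J \<in> \<Omega> \<longrightarrow>
           ((\<lambda>t. f (qpt t y J)) has_vector_derivative fx (qpt x y J)) (at x) \<and>
           ((\<lambda>t. f (qpt x t J)) has_vector_derivative fy (qpt x y J)) (at y) \<and>
           (1 / 2) *\<^sub>R (fx (qpt x y J) + J * fy (qpt x y J)) = 0))"

section \<open>Spherical value, spherical derivative and regular product\<close>

text \<open>
  The pair \<open>(b, c)\<close> attached to a nonreal point \<open>q\<close>, for which \<open>x = q_re q\<close> and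
  \<open>y = norm (q_Im q) > 0\<close> are the unique reals with \<open>y > 0\<close> and \<open>q \<in> qsphere x y\<close>.
  Two distinct units \<open>I\<close>, \<open>J\<close> determine \<open>b\<close> and \<open>c\<close> from \<open>b + I * c\<close> and \<open>b + J * c\<close>, and two
  neighbourhoods of \<open>q\<close> meet in a neighbourhood of \<open>q\<close>, so there is at most one such pair.
\<close>
definition spherical_pair :: "quat set \<Rightarrow> (quat \<Rightarrow> quat) \<Rightarrow> quat \<Rightarrow> quat \<times> quat" where
  "spherical_pair \<Omega> f q =
     (let x = q_re q; y = norm (q_Im q) in
      THE (b, c). \<exists>U. openin (top_of_set (qsphere x y)) U \<and> q \<in> U \<and> U \<subseteq> \<Omega> \<and>
        (\<forall>J\<in>imag_units. qpt x y J \<in> U \<longrightarrow> f (qpt x y J) = b + J * c))"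

definition spherical_value :: "quat set \<Rightarrow> (quat \<Rightarrow> quat) \<Rightarrow> quat \<Rightarrow> quat" where
  "spherical_value \<Omega> f q = (if q \<in> \<real> then f q else fst (spherical_pair \<Omega> f q))"

text \<open>Only meaningful at nonreal points.\<close>
definition spherical_deriv :: "quat set \<Rightarrow> (quat \<Rightarrow> quat) \<Rightarrow> quat \<Rightarrow> quat" where
  "spherical_deriv \<Omega> f q = inverse (norm (q_Im q)) *\<^sub>R snd (spherical_pair \<Omega> f q)"

definition regular_prod :: "quat set \<Rightarrow> (quat \<Rightarrow> quat) \<Rightarrow> (quat \<Rightarrow> quat) \<Rightarrow> quat \<Rightarrow> quat" where
  "regular_prod \<Omega> f g q =
     (if q \<in> \<real> then f q * g q
      else spherical_value \<Omega> f q * spherical_value \<Omega> g q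
         + (q_Im q)\<^sup>2 * spherical_deriv \<Omega> f q * spherical_deriv \<Omega> g q
         + q_Im q * (spherical_value \<Omega> f q * spherical_deriv \<Omega> g q
                     + spherical_deriv \<Omega> f q * spherical_value \<Omega> g q))"

end

theory Submission
  imports Defs "HOL-Complex_Analysis.Complex_Analysis"
begin

text \<open>
  Every slice regular function \<open>f\<close> on a slice domain is locally induced by a holomorphic stem: near
  each point \<open>x + y I\<close> there are quaternion valued functions \<open>b\<close> and \<open>c\<close> of \<open>z = x + \<i> y\<close> with
  \<open>f (x + y J) = b z + J c z\<close> for all \<open>J\<close> near \<open>I\<close>, such that \<open>b + \<iota> c\<close> is holomorphic with values in the
  complexified quaternions (\<open>local_stem_exists\<close>). Such stems exist near the real axis, because two slices
  determine a candidate that agrees with \<open>f\<close> on the reals, and the identity principle on the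
  individual slices propagates them through the connected slice of the domain. They yield the spherical value
  \<open>b z\<close> and the spherical derivative \<open>c z / y\<close>.

  In terms of stems the regular product is the ordinary product, so that the equation
  \<open>f = (q - p) * g\<close> becomes \<open>F = (z - p) G\<close>. Since \<open>(z - p) (z - q_conj p)\<close> is the complex scalar
  \<open>(z - w) (z - cnj w)\<close>, where \<open>w = x\<^sub>0 + \<i> y\<^sub>0\<close>, its only solution away from the sphere of \<open>p\<close> is
  \<open>G = (z - q_conj p) F / ((z - w) (z - cnj w))\<close>, a formula that can be written globally in terms of the
  spherical value and derivative of \<open>f\<close>. At a point of the sphere the denominator has a simple zero, so
  \<open>G\<close> extends holomorphically if and only if \<open>(z - q_conj p) F\<close> vanishes there. By \<open>exceptional_iff\<close> this
  vanishing is the equation \<open>spherical_value \<Omega> f q = - q_Im p * spherical_deriv \<Omega> f q\<close> that fails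
  exactly on the exceptional set. This gives the quotient outside that set (\<open>stem_division\<close>,
  \<open>regular_quotient_local_stem\<close>) and its nonexistence near any point of it (\<open>no_regular_quotient\<close>).
  The exceptional set is closed in \<open>\<Omega>\<close>, because the spherical value and derivative are locally constant
  on the sphere, and it meets each slice in at most two nonreal points; so its complement is again a
  slice domain.
\<close>

section \<open>Quaternions in slice coordinates\<close>

lemma imag_units_iff: "J \<in> imag_units \<longleftrightarrow> q_re J = 0 \<and> norm J = 1"
proof
  assume "J \<in> imag_units"
  then have J: "J * J = - 1"
    by (simp add: imag_units_def power2_eq_square)
  have "norm J * norm J = 1"
    by (simp add: J flip: norm_mult)
  then have n: "norm J = 1"
    by (metis norm_ge_zero power2_eq_square real_sqrt_abs real_sqrt_one abs_of_nonneg)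
  then have "(q_re J)\<^sup>2 + (q_i J)\<^sup>2 + (q_j J)\<^sup>2 + (q_k J)\<^sup>2 = 1"
    by (simp add: norm_quat_def)
  moreover have "q_re J * q_re J - q_i J * q_i J - q_j J * q_j J - q_k J * q_k J = - 1"
    using arg_cong [OF J, of q_re] by simp
  ultimately have "q_re J = 0"
    by (simp add: power2_eq_square) (smt (verit) mult_eq_0_iff)
  with n show "q_re J = 0 \<and> norm J = 1" by simp
next
  assume J: "q_re J = 0 \<and> norm J = 1"
  then have "(q_i J)\<^sup>2 + (q_j J)\<^sup>2 + (q_k J)\<^sup>2 = 1"
    by (auto simp: norm_quat_def)
  then show "J \<in> imag_units"
    using J by (simp add: imag_units_def quat_eq_iff power2_eq_square)
qed

lemma imag_units_square: "J \<in> imag_units \<Longrightarrow> J * J = - 1"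
  by (simp add: imag_units_def power2_eq_square)

lemma imag_units_square_assoc: "J \<in> imag_units \<Longrightarrow> J * (J * q) = - q"
  by (simp add: imag_units_square flip: mult.assoc)

lemma imag_units_uminus: "J \<in> imag_units \<Longrightarrow> - J \<in> imag_units"
  by (simp add: imag_units_def)

text \<open>
  The sphere of imaginary units has no isolated point: conjugating \<open>I\<close> by \<open>1 + t * w\<close>, where \<open>w\<close>
  does not commute with \<open>I\<close>, moves \<open>I\<close> by an arbitrarily small amount as \<open>t\<close> tends to \<open>0\<close>.
\<close>
lemma imag_units_near:
  assumes I: "I \<in> imag_units" and "\<epsilon> > 0"
  obtains J where "J \<in> imag_units" "J \<noteq> I" "dist J I < \<epsilon>"
proof -
  \<comment> \<open>A quaternion commuting with both \<open>i\<close> and \<open>j\<close> is real.\<close>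
  obtain w where w: "w * I \<noteq> I * w"
  proof (rule ccontr)
    assume "\<not> thesis"
    then have "w * I = I * w" for w
      using that by blast
    from this[of "Quat 0 1 0 0"] this[of "Quat 0 0 1 0"]
    have "q_i I = 0" "q_j I = 0" "q_k I = 0"
      by (simp_all add: quat_eq_iff)
    then show False
      using I by (auto simp: imag_units_iff norm_quat_def)
  qed
  define J where "J t = (1 + of_real t * w) * I * inverse (1 + of_real t * w)" for t
  have "(J \<longlongrightarrow> (1 + of_real 0 * w) * I * inverse (1 + of_real 0 * w)) (at_right 0)"
    unfolding J_def by (intro tendsto_intros) simp
  then have "(J \<longlongrightarrow> I) (at_right 0)"
    by simp
  then have near: "eventually (\<lambda>t. dist (J t) I < \<epsilon>) (at_right 0)"
    using \<open>\<epsilon> > 0\<close> tendstoD by blast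
  have "((\<lambda>t. 1 + of_real t * w) \<longlongrightarrow> 1 + of_real 0 * w) (at_right 0)"
    by (intro tendsto_intros)
  then have "eventually (\<lambda>t. 1 + of_real t * w \<noteq> 0) (at_right 0)"
    by (intro tendsto_imp_eventually_ne) auto
  then have "eventually (\<lambda>t. dist (J t) I < \<epsilon> \<and> 1 + of_real t * w \<noteq> 0 \<and> t > 0) (at_right 0)"
    using near eventually_at_right_less by eventually_elim auto
  then obtain t where t: "dist (J t) I < \<epsilon>" "1 + of_real t * w \<noteq> 0" "t > 0"
    using eventually_happens trivial_limit_at_right_real by blast
  define u where "u = 1 + of_real t * w"
  have u: "u \<noteq> 0"
    using t by (simp add: u_def)
  have Jt: "J t = u * I * inverse u"
    by (simp add: J_def u_def)
  have inv: "inverse u * (u * q) = q" "inverse u * u = 1" for q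
    using u by (simp_all flip: mult.assoc)
  have "J t * J t = - 1"
    unfolding Jt by (simp add: inv mult.assoc imag_units_square_assoc[OF I] u)
  then have unit: "J t \<in> imag_units"
    by (simp add: imag_units_def power2_eq_square)
  have "J t \<noteq> I"
  proof
    assume "J t = I"
    then have "u * I = I * u"
      using arg_cong[of _ _ "\<lambda>x. x * u"] by (metis Jt inv(2) mult.assoc mult.right_neutral)
    then have "of_real t * (w * I) = of_real t * (I * w)"
      by (simp add: u_def algebra_simps of_real_def)
    then show False
      using w t by simp
  qed
  with unit t that show thesis by blast
qed

text \<open>
  The point \<open>x + y I\<close> attached to the complex number \<open>z = x + \<i> y\<close>. For a fixed imaginary unit \<open>I\<close>
  this is an isomorphism of the complex field onto \<open>slice_plane I\<close>; a nonreal quaternion is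
  represented exactly twice, by \<open>(z, I)\<close> and by \<open>(cnj z, - I)\<close>.
\<close>
definition slice_pt :: "complex \<Rightarrow> quat \<Rightarrow> quat" where
  "slice_pt z I = qpt (Re z) (Im z) I"

lemma slice_pt_eq: "slice_pt z I = of_real (Re z) + Im z *\<^sub>R I"
  by (simp add: slice_pt_def qpt_def scaleR_conv_of_real)

lemma qpt_eq_slice_pt: "qpt x y I = slice_pt (Complex x y) I"
  by (simp add: slice_pt_def)

lemma slice_pt_mult:
  assumes "I \<in> imag_units"
  shows "slice_pt (z * w) I = slice_pt z I * slice_pt w I"
  using imag_units_square[OF assms] by (simp add: slice_pt_eq algebra_simps of_real_def)

lemma slice_pt_1 [simp]: "slice_pt 1 I = 1" and slice_pt_0 [simp]: "slice_pt 0 I = 0"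
  by (simp_all add: slice_pt_eq)

lemma slice_pt_cnj_uminus: "slice_pt (cnj z) (- I) = slice_pt z I"
  by (simp add: slice_pt_eq)

lemma slice_pt_coords:
  assumes "I \<in> imag_units"
  shows "q_re (slice_pt z I) = Re z" "q_Im (slice_pt z I) = Im z *\<^sub>R I"
    "norm (q_Im (slice_pt z I)) = \<bar>Im z\<bar>" "slice_pt z I \<bullet> I = Im z"
    "slice_pt z I \<in> \<real> \<longleftrightarrow> Im z = 0"
proof -
  have I: "q_re I = 0" "norm I = 1" "I \<bullet> I = 1"
    using assms by (auto simp: imag_units_iff dot_square_norm)
  show re: "q_re (slice_pt z I) = Re z"
    by (simp add: slice_pt_eq I)
  show im: "q_Im (slice_pt z I) = Im z *\<^sub>R I"
    by (simp add: q_Im_def re) (simp add: slice_pt_eq)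
  show "norm (q_Im (slice_pt z I)) = \<bar>Im z\<bar>"
    by (simp add: im I)
  have "of_real x \<bullet> I = 0" for x
    by (simp add: inner_quat_def I)
  then show "slice_pt z I \<bullet> I = Im z"
    by (simp add: slice_pt_eq inner_add_left I)
  show "slice_pt z I \<in> \<real> \<longleftrightarrow> Im z = 0"
  proof
    assume "slice_pt z I \<in> \<real>"
    then have "q_Im (slice_pt z I) = 0"
      by (auto simp: Reals_def q_Im_def)
    then show "Im z = 0"
      using I by (auto simp: im)
  qed (simp add: slice_pt_eq)
qed

text \<open>
  A continuous left inverse of \<open>\<lambda>z. slice_pt z I\<close>, defined on the whole algebra of quaternions: on
  \<open>slice_plane I\<close> the imaginary coordinate is the inner product with \<open>I\<close>.
\<close>
definition slice_coord :: "quat \<Rightarrow> quat \<Rightarrow> complex" where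
  "slice_coord I q = Complex (q_re q) (q \<bullet> I)"

lemma slice_coord_slice_pt: "I \<in> imag_units \<Longrightarrow> slice_coord I (slice_pt z I) = z"
  by (simp add: slice_coord_def slice_pt_coords)

lemma continuous_on_q_re [continuous_intros]: "continuous_on S g \<Longrightarrow> continuous_on S (\<lambda>x. q_re (g x))"
proof -
  assume g: "continuous_on S g"
  have "q_re q = q \<bullet> 1" for q by (simp add: inner_quat_def)
  then show ?thesis using g by (auto intro!: continuous_intros)
qed

lemma continuous_on_slice_coord: "continuous_on S (slice_coord I)"
  unfolding slice_coord_def by (intro continuous_intros)

lemma slice_pt_inverse:
  assumes "I \<in> imag_units"
  shows "slice_pt (inverse z) I = inverse (slice_pt z I)"
proof (cases "z = 0")
  case False
  then have "slice_pt (inverse z) I * slice_pt z I = 1"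
    by (simp flip: slice_pt_mult[OF assms])
  then show ?thesis
    by (metis inverse_inverse_eq inverse_unique)
qed simp

lemma slice_pt_exists:
  obtains z I where "I \<in> imag_units" "q = slice_pt z I" "Im z \<ge> 0"
proof (cases "q_Im q = 0")
  case True
  have "Quat 0 1 0 0 \<in> imag_units"
    by (simp add: imag_units_iff norm_quat_def)
  moreover have "q = slice_pt (of_real (q_re q)) (Quat 0 1 0 0)"
    using True by (simp add: slice_pt_eq q_Im_def)
  ultimately show thesis
    using that by fastforce
next
  case False
  define y where "y = norm (q_Im q)"
  have y: "y > 0"
    using False by (simp add: y_def)
  define I where "I = q_Im q /\<^sub>R y"
  have "I \<in> imag_units"
    using y by (simp add: imag_units_iff I_def q_Im_def) (simp add: y_def q_Im_def)
  moreover have "q = slice_pt (Complex (q_re q) y) I"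
    using y by (simp add: slice_pt_eq I_def) (simp add: q_Im_def)
  ultimately show thesis
    using that[of I "Complex (q_re q) y"] y by simp
qed

lemma slice_plane_iff: "q \<in> slice_plane I \<longleftrightarrow> (\<exists>z. q = slice_pt z I)"
  by (auto simp: slice_plane_def slice_pt_def) (metis complex.sel)

lemma of_real_eq_slice_pt: "of_real x = slice_pt (of_real x) I"
  by (simp add: slice_pt_eq)

lemma continuous_on_slice_pt [continuous_intros]:
  "continuous_on S g \<Longrightarrow> continuous_on S h \<Longrightarrow> continuous_on S (\<lambda>x. slice_pt (g x) (h x))"
  unfolding slice_pt_eq by (intro continuous_intros)

lemma open_slice_preimage: "open \<Omega> \<Longrightarrow> open {z. slice_pt z I \<in> \<Omega>}"
proof -
  assume "open \<Omega>"
  have "continuous_on UNIV (\<lambda>z. slice_pt z I)"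
    by (intro continuous_intros)
  then show ?thesis
    using continuous_open_vimage[of \<Omega>] \<open>open \<Omega>\<close>
    by (metis continuous_on_eq_continuous_at open_UNIV UNIV_I vimage_def)
qed

lemma slice_tube:
  assumes "open \<Omega>" and "slice_pt z I \<in> \<Omega>"
  obtains r where "r > 0" "\<And>w J. dist z w < r \<Longrightarrow> dist J I < r \<Longrightarrow> slice_pt w J \<in> \<Omega>"
proof -
  have "continuous_on UNIV (\<lambda>(w, J). slice_pt w J)"
    unfolding split_beta by (intro continuous_intros)
  then have "open ((\<lambda>(w, J). slice_pt w J) -` \<Omega>)"
    using assms(1) by (simp add: continuous_on_open_vimage)
  then obtain A B where "open A" "open B" "(z, I) \<in> A \<times> B" "A \<times> B \<subseteq> (\<lambda>(w, J). slice_pt w J) -` \<Omega>"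
    using assms(2) by (auto elim!: open_prod_elim[of _ "(z, I)"])
  then obtain a b where "a > 0" "b > 0" and sub: "ball z a \<subseteq> A" "ball I b \<subseteq> B"
    by (meson mem_Sigma_iff open_contains_ball)
  show thesis
  proof (rule that[of "min a b"])
    show "min a b > 0" using \<open>a > 0\<close> \<open>b > 0\<close> by simp
    fix w J assume "dist z w < min a b" "dist J I < min a b"
    then have "(w, J) \<in> A \<times> B" using sub by (auto simp: dist_commute)
    then show "slice_pt w J \<in> \<Omega>"
      using \<open>A \<times> B \<subseteq> _\<close> by auto
  qed
qed

text \<open>
  Quaternionic conjugation. It makes left multiplication by \<open>q_conj a\<close> the adjoint of left
  multiplication by \<open>a\<close>.
\<close>
definition q_conj :: "quat \<Rightarrow> quat" where
  "q_conj a = Quat (q_re a) (- q_i a) (- q_j a) (- q_k a)"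

lemma inner_mult_left_adjoint: "(a * u) \<bullet> v = u \<bullet> (q_conj a * v)" for u :: quat
  by (simp add: inner_quat_def q_conj_def algebra_simps)

section \<open>Slice regularity as holomorphy\<close>

text \<open>
  Left multiplication by an imaginary unit \<open>I\<close> makes the quaternions a complex vector space. The
  functionals \<open>slice_comp I v\<close> are complex linear for this structure, their real parts are the
  functionals \<open>\<lambda>h. h \<bullet> v\<close>, and together they separate points; no basis of the complex structure has
  to be chosen.
\<close>
definition slice_comp :: "quat \<Rightarrow> quat \<Rightarrow> quat \<Rightarrow> complex" where
  "slice_comp I v h = Complex (h \<bullet> v) (- ((I * h) \<bullet> v))"

lemma bounded_linear_slice_comp: "bounded_linear (slice_comp I v)"
proof -
  have "bounded_linear (\<lambda>h. of_real (h \<bullet> v) - \<i> * of_real ((I * h) \<bullet> v))"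
    by (intro bounded_linear_sub bounded_linear_compose[OF bounded_linear_of_real]
        bounded_linear_const_mult bounded_linear_inner_left_comp bounded_linear_mult_right bounded_linear_ident)
  then show ?thesis
    by (simp add: slice_comp_def[abs_def] Complex_eq algebra_simps)
qed

lemma slice_comp_mult:
  assumes "I \<in> imag_units"
  shows "slice_comp I v (I * h) = \<i> * slice_comp I v h"
  by (simp add: slice_comp_def complex_eq_iff imag_units_square_assoc[OF assms])

lemma slice_comp_eq_0D: "(\<And>v. slice_comp I v h = 0) \<Longrightarrow> h = 0"
  using inner_eq_zero_iff[of h] by (fastforce simp: slice_comp_def complex_eq_iff)

text \<open>
  Holomorphy of a quaternion valued function with respect to the complex structure given by left
  multiplication by \<open>I\<close>, tested by the functionals above.
\<close>
definition slice_holo :: "quat \<Rightarrow> complex set \<Rightarrow> (complex \<Rightarrow> quat) \<Rightarrow> bool" where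
  "slice_holo I D h \<longleftrightarrow> (\<forall>v. (\<lambda>z. slice_comp I v (h z)) holomorphic_on D)"

lemma slice_holo_diff: "slice_holo I D h \<Longrightarrow> slice_holo I D k \<Longrightarrow> slice_holo I D (\<lambda>z. h z - k z)"
  unfolding slice_holo_def
  by (simp add: bounded_linear.linear linear_diff[OF bounded_linear.linear[OF bounded_linear_slice_comp]] holomorphic_on_diff)

text \<open>The identity principle.\<close>
lemma slice_holo_eq_0:
  assumes "slice_holo I D h" "open D" "connected D" "Z \<subseteq> D" "\<zeta> \<in> D" "\<zeta> islimpt Z"
    and "\<And>z. z \<in> Z \<Longrightarrow> h z = 0" and "w \<in> D"
  shows "h w = 0"
proof (rule slice_comp_eq_0D)
  fix v
  show "slice_comp I v (h w) = 0"
  proof (rule analytic_continuation[of "\<lambda>z. slice_comp I v (h z)" D Z \<zeta>])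
    show "(\<lambda>z. slice_comp I v (h z)) holomorphic_on D"
      using assms(1) by (simp add: slice_holo_def)
  qed (use assms in \<open>auto simp: slice_comp_def complex_eq_iff\<close>)
qed

text \<open>Continuity of one of the two partial derivatives suffices for differentiability.\<close>
lemma has_derivative_of_partials:
  fixes F :: "real \<Rightarrow> real \<Rightarrow> 'a :: real_normed_vector"
  assumes D: "open D" "z \<in> D"
    and x: "\<And>w. w \<in> D \<Longrightarrow> ((\<lambda>t. F t (Im w)) has_vector_derivative Fx w) (at (Re w))"
    and y: "\<And>w. w \<in> D \<Longrightarrow> ((\<lambda>t. F (Re w) t) has_vector_derivative Fy w) (at (Im w))"
    and cont: "continuous_on D Fy"
  shows "((\<lambda>z. F (Re z) (Im z)) has_derivative (\<lambda>h. Re h *\<^sub>R Fx z + Im h *\<^sub>R Fy z)) (at z)"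
proof -
  have "open ((\<lambda>(x, y). Complex x y) -` D)"
    using D by (intro open_vimage continuous_intros) (auto simp: split_beta intro!: continuous_intros)
  then obtain A B where AB: "open A" "open B" "(Re z, Im z) \<in> A \<times> B" "A \<times> B \<subseteq> (\<lambda>(x, y). Complex x y) -` D"
    using D(2) by (auto elim!: open_prod_elim[of _ "(Re z, Im z)"])
  obtain b where b: "b > 0" "ball (Im z) b \<subseteq> B"
    using AB by (meson mem_Sigma_iff open_contains_ball)
  define Y where "Y = ball (Im z) b"
  have sub: "Complex s t \<in> D" if "s \<in> A" "t \<in> Y" for s t
  proof -
    have "(s, t) \<in> A \<times> B" using that b by (auto simp: Y_def)
    then show ?thesis using AB(4) by auto
  qed
  have z: "Re z \<in> A" "Im z \<in> Y" "open Y" "convex Y"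
    using AB b by (auto simp: Y_def)
  have "((\<lambda>(s, t). F s t) has_derivative
      (\<lambda>(s, t). s *\<^sub>R Fx z + blinfun_apply (blinfun_scaleR_left (Fy (Complex (Re z) (Im z)))) t)) (at (Re z, Im z) within A \<times> Y)"
  proof (rule has_derivative_partialsI)
    show "((\<lambda>x. F x (Im z)) has_derivative (\<lambda>s. s *\<^sub>R Fx z)) (at (Re z) within A)"
      using x[OF D(2)] by (simp add: has_vector_derivative_def has_derivative_at_withinI)
    show "((\<lambda>y. F s y) has_derivative blinfun_apply (blinfun_scaleR_left (Fy (Complex s t)))) (at t within Y)"
      if "s \<in> A" "t \<in> Y" for s t
      using y[OF sub[OF that]] by (simp add: has_vector_derivative_def has_derivative_at_withinI)
    have "continuous_on (A \<times> Y) (\<lambda>u. blinfun_scaleR_left (Fy (Complex (fst u) (snd u))))"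
      by (intro continuous_intros continuous_on_compose2[OF cont]) (auto intro: sub)
    then show "continuous (at (Re z, Im z) within A \<times> Y) (\<lambda>(x, y). blinfun_scaleR_left (Fy (Complex x y)))"
      using z by (simp add: continuous_on_eq_continuous_within case_prod_unfold)
  qed (use z in auto)
  then have "((\<lambda>(s, t). F s t) has_derivative (\<lambda>(s, t). s *\<^sub>R Fx z + t *\<^sub>R Fy z)) (at (Re z, Im z))"
    using z AB by (subst (asm) at_within_open) (auto intro: open_Times)
  moreover have "((\<lambda>z. (Re z, Im z)) has_derivative (\<lambda>h. (Re h, Im h))) (at z)"
    by (auto intro!: derivative_eq_intros)
  ultimately show ?thesis
    by (auto dest: has_derivative_compose)
qed

text \<open>
  On an open set, slice regularity is the same as holomorphy on each slice. Continuity of the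
  partial derivatives makes the restriction to a slice differentiable, and the equation
  \<open>a + I * b = 0\<close> between its partial derivatives \<open>a\<close>, \<open>b\<close> says that the derivative is complex
  linear.
\<close>
lemma slice_regular_imp_slice_holo:
  assumes "open \<Omega>" "slice_regular \<Omega> f" and I: "I \<in> imag_units"
  shows "slice_holo I {z. slice_pt z I \<in> \<Omega>} (\<lambda>z. f (slice_pt z I))"
proof -
  define D where "D = {z. slice_pt z I \<in> \<Omega>}"
  have D: "open D"
    using open_slice_preimage[OF assms(1)] by (simp add: D_def)
  obtain fx fy where cont: "continuous_on (\<Omega> \<inter> slice_plane I) fy"
    and pd: "\<And>x y. qpt x y I \<in> \<Omega> \<Longrightarrow>
           ((\<lambda>t. f (qpt t y I)) has_vector_derivative fx (qpt x y I)) (at x) \<and>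
           ((\<lambda>t. f (qpt x t I)) has_vector_derivative fy (qpt x y I)) (at y) \<and>
           (1 / 2) *\<^sub>R (fx (qpt x y I) + I * fy (qpt x y I)) = 0"
    using assms(2) I unfolding slice_regular_def by meson
  have "(\<lambda>z. slice_comp I v (f (slice_pt z I))) field_differentiable (at z)" if "z \<in> D" for z v
  proof -
    define a where "a = fx (slice_pt z I)"
    define b where "b = fy (slice_pt z I)"
    have "((\<lambda>z. f (qpt (Re z) (Im z) I)) has_derivative (\<lambda>h. Re h *\<^sub>R a + Im h *\<^sub>R b)) (at z)"
      unfolding a_def b_def
    proof (rule has_derivative_of_partials[OF D that])
      show "continuous_on D (\<lambda>z. fy (slice_pt z I))"
        by (rule continuous_on_compose2[OF cont]) (auto simp: D_def slice_plane_iff intro!: continuous_intros)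
    qed (use pd in \<open>auto simp: D_def slice_pt_def\<close>)
    then have "((\<lambda>z. slice_comp I v (f (slice_pt z I))) has_derivative
        (\<lambda>h. slice_comp I v (Re h *\<^sub>R a + Im h *\<^sub>R b))) (at z)"
      using bounded_linear.has_derivative[OF bounded_linear_slice_comp] by (simp add: slice_pt_def)
    moreover have "slice_comp I v (Re h *\<^sub>R a + Im h *\<^sub>R b) = slice_comp I v a * h" for h
    proof -
      have "a + I * b = 0"
        using pd[of "Re z" "Im z"] that by (simp add: D_def a_def b_def slice_pt_def)
      then have "I * (a + I * b) = 0" by simp
      then have b: "b = I * a"
        by (simp add: ring_distribs imag_units_square_assoc[OF I])
      have lin: "slice_comp I v (r *\<^sub>R h + s *\<^sub>R k) = of_real r * slice_comp I v h + of_real s * slice_comp I v k" for r s h k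
        by (simp add: slice_comp_def complex_eq_iff inner_add_left ring_distribs)
      show ?thesis
        unfolding lin b slice_comp_mult[OF I] by (subst (3) complex_eq) (simp add: algebra_simps)
    qed
    ultimately show ?thesis
      unfolding field_differentiable_def has_field_derivative_def by (intro exI[of _ "slice_comp I v a"]) simp
  qed
  then show ?thesis
    using D unfolding slice_holo_def by (simp add: holomorphic_on_open field_differentiable_def flip: D_def)
qed

text \<open>
  Conversely, the partial derivatives are recovered componentwise from the complex derivatives of
  the functions \<open>\<Phi> v\<close>.
\<close>
lemma slice_holo_imp_slice_regular:
  assumes "open \<Omega>"
    and holo: "\<And>I. I \<in> imag_units \<Longrightarrow> slice_holo I {z. slice_pt z I \<in> \<Omega>} (\<lambda>z. f (slice_pt z I))"
  shows "slice_regular \<Omega> f"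
  unfolding slice_regular_def
proof
  fix I assume I: "I \<in> imag_units"
  define D where "D = {z. slice_pt z I \<in> \<Omega>}"
  have D: "open D"
    using open_slice_preimage[OF assms(1)] by (simp add: D_def)
  define \<Phi> where "\<Phi> v z = slice_comp I v (f (slice_pt z I))" for v z
  have \<Phi>: "\<Phi> v holomorphic_on D" for v
    using holo[OF I] by (simp add: slice_holo_def \<Phi>_def[abs_def] D_def)
  have \<Phi>': "(\<Phi> v has_field_derivative deriv (\<Phi> v) z) (at z)" if "z \<in> D" for v z
    using \<Phi> D that holomorphic_derivI by blast
  have cont: "continuous_on D (deriv (\<Phi> v))" for v
    using \<Phi> D holomorphic_deriv holomorphic_on_imp_continuous_on by blast
  define gx where "gx z = (\<Sum>v\<in>Basis. Re (deriv (\<Phi> v) z) *\<^sub>R v)" for z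
  define gy where "gy z = (\<Sum>v\<in>Basis. - Im (deriv (\<Phi> v) z) *\<^sub>R v)" for z
  let ?co = "slice_coord I"
  note co = slice_coord_slice_pt[OF I]
  have co_D: "?co ` (\<Omega> \<inter> slice_plane I) \<subseteq> D"
    by (auto simp: slice_plane_iff co D_def)
  have line: "((\<lambda>t. slice_comp I v (f (slice_pt (z + of_real t * e) I))) has_vector_derivative e * deriv (\<Phi> v) z) (at 0)"
    if "z \<in> D" for v z e
  proof -
    have "((\<lambda>t. z + of_real t * e) has_vector_derivative e) (at 0)"
      by (auto intro!: derivative_eq_intros simp: has_vector_derivative_def scaleR_conv_of_real)
    then show ?thesis
      using field_vector_diff_chain_at[of "\<lambda>t. z + of_real t * e" e 0 "\<Phi> v"] \<Phi>'[OF that, of v]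
      by (simp add: \<Phi>_def o_def)
  qed
  have deriv_line: "((\<lambda>t. f (slice_pt (z + of_real t * e) I)) has_vector_derivative
      (\<Sum>v\<in>Basis. Re (e * deriv (\<Phi> v) z) *\<^sub>R v)) (at 0)" if "z \<in> D" for z e
  proof -
    have "((\<lambda>t. f (slice_pt (z + of_real t * e) I) \<bullet> v) has_vector_derivative Re (e * deriv (\<Phi> v) z)) (at 0)" for v
      using bounded_linear.has_vector_derivative[OF bounded_linear_Re line[OF that]]
      by (simp add: slice_comp_def)
    then show ?thesis
      unfolding has_vector_derivative_def
      by (subst has_derivative_componentwise_within) (auto simp: inner_sum_left inner_Basis if_distrib cong: if_cong)
  qed
  have CR: "gx z + I * gy z = 0" if "z \<in> D" for z
  proof -
    have y: "((\<lambda>t. f (slice_pt (z + of_real t * \<i>) I)) has_vector_derivative gy z) (at 0)"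
      using deriv_line[OF that, of \<i>] by (simp add: gy_def)
    have "(I * gy z) \<bullet> v = - Re (deriv (\<Phi> v) z)" for v
    proof -
      have "((\<lambda>t. slice_comp I v (f (slice_pt (z + of_real t * \<i>) I))) has_vector_derivative slice_comp I v (gy z)) (at 0)"
        using bounded_linear.has_vector_derivative[OF bounded_linear_slice_comp y] .
      then have "slice_comp I v (gy z) = \<i> * deriv (\<Phi> v) z"
        using line[OF that, of v \<i>] vector_derivative_unique_at by blast
      then show ?thesis
        by (simp add: slice_comp_def complex_eq_iff)
    qed
    moreover have "gx z \<bullet> v = Re (deriv (\<Phi> v) z)" if "v \<in> Basis" for v
      using that by (simp add: gx_def inner_sum_left inner_Basis if_distrib cong: if_cong)
    ultimately show ?thesis
      by (subst euclidean_eq_iff) (simp add: inner_add_left)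
  qed
  show "\<exists>fx fy.
        continuous_on (\<Omega> \<inter> slice_plane I) fx \<and>
        continuous_on (\<Omega> \<inter> slice_plane I) fy \<and>
        (\<forall>x y. qpt x y I \<in> \<Omega> \<longrightarrow>
           ((\<lambda>t. f (qpt t y I)) has_vector_derivative fx (qpt x y I)) (at x) \<and>
           ((\<lambda>t. f (qpt x t I)) has_vector_derivative fy (qpt x y I)) (at y) \<and>
           (1 / 2) *\<^sub>R (fx (qpt x y I) + I * fy (qpt x y I)) = 0)"
  proof (rule exI[of _ "gx \<circ> ?co"], rule exI[of _ "gy \<circ> ?co"], intro conjI allI impI)
    have "continuous_on D gx" "continuous_on D gy"
      unfolding gx_def gy_def by (intro continuous_intros cont)+
    then show "continuous_on (\<Omega> \<inter> slice_plane I) (gx \<circ> ?co)" "continuous_on (\<Omega> \<inter> slice_plane I) (gy \<circ> ?co)"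
      using continuous_on_compose2[OF _ continuous_on_slice_coord co_D] by (auto simp: o_def)
    fix x y assume "qpt x y I \<in> \<Omega>"
    then have z: "Complex x y \<in> D"
      by (simp add: D_def qpt_eq_slice_pt)
    have shift: "(h has_vector_derivative d) (at s)" if "((\<lambda>t. h (s + t)) has_vector_derivative d) (at 0)"
      for h :: "real \<Rightarrow> quat" and d s
    proof -
      have "((\<lambda>t. t - s) has_real_derivative 1) (at s)"
        by (auto intro!: derivative_eq_intros)
      then have "((\<lambda>t. t - s) has_vector_derivative 1) (at s)"
        by (simp add: has_real_derivative_iff_has_vector_derivative)
      then show ?thesis
        using vector_diff_chain_at[of "\<lambda>t. t - s" 1 s "\<lambda>t. h (s + t)" d] that by (simp add: o_def)
    qed
    have "Complex x y + of_real t = Complex (x + t) y" "Complex x y + of_real t * \<i> = Complex x (y + t)" for t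
      by (simp_all add: complex_eq_iff)
    then show "((\<lambda>t. f (qpt t y I)) has_vector_derivative (gx \<circ> ?co) (qpt x y I)) (at x)"
      "((\<lambda>t. f (qpt x t I)) has_vector_derivative (gy \<circ> ?co) (qpt x y I)) (at y)"
      using deriv_line[OF z, of 1] deriv_line[OF z, of \<i>]
      by (auto simp: qpt_eq_slice_pt co gx_def gy_def intro!: shift)
    show "(1 / 2) *\<^sub>R ((gx \<circ> ?co) (qpt x y I) + I * (gy \<circ> ?co) (qpt x y I)) = 0"
      using CR[OF z] by (simp add: qpt_eq_slice_pt co)
  qed
qed

section \<open>Stem functions\<close>

text \<open>
  A pair \<open>(b, c)\<close> stands for the function \<open>b + \<iota> c\<close> with values in the complexified quaternions,
  \<open>\<iota>\<close> being the central imaginary unit of the complexification. Holomorphy is tested on the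
  components of \<open>b + \<iota> c\<close> along all quaternions \<open>v\<close>.
\<close>
definition stem_holo :: "complex set \<Rightarrow> (complex \<Rightarrow> quat) \<Rightarrow> (complex \<Rightarrow> quat) \<Rightarrow> bool" where
  "stem_holo D b c \<longleftrightarrow> (\<forall>v. (\<lambda>z. Complex (b z \<bullet> v) (c z \<bullet> v)) holomorphic_on D)"

lemma stem_holo_subset: "stem_holo D b c \<Longrightarrow> D' \<subseteq> D \<Longrightarrow> stem_holo D' b c"
  unfolding stem_holo_def using holomorphic_on_subset by blast

text \<open>Replacing \<open>\<iota>\<close> by a quaternionic imaginary unit \<open>I\<close> turns a holomorphic stem into an
  \<open>I\<close>-holomorphic function.\<close>
lemma stem_holo_imp_slice_holo:
  assumes "stem_holo D b c" and I: "I \<in> imag_units"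
  shows "slice_holo I D (\<lambda>z. b z + I * c z)"
  unfolding slice_holo_def
proof
  fix v
  let ?w = "q_conj I * v"
  have "(\<lambda>z. Complex (b z \<bullet> v) (c z \<bullet> v) - \<i> * Complex (b z \<bullet> ?w) (c z \<bullet> ?w)) holomorphic_on D"
    using assms(1) unfolding stem_holo_def by (intro holomorphic_intros) auto
  moreover have "slice_comp I v (b z + I * c z)
      = Complex (b z \<bullet> v) (c z \<bullet> v) - \<i> * Complex (b z \<bullet> ?w) (c z \<bullet> ?w)" for z
    by (simp add: slice_comp_def complex_eq_iff ring_distribs imag_units_square_assoc[OF I]
        inner_add_left inner_diff_left flip: inner_mult_left_adjoint)
  ultimately show "(\<lambda>z. slice_comp I v (b z + I * c z)) holomorphic_on D"
    by simp
qed

text \<open>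
  With \<open>a = inverse (J - K)\<close> this is the stem interpolating the slice functions \<open>h\<close> and \<open>k\<close> on the
  slices of \<open>J\<close> and \<open>K\<close>. In this shape each component of the stem is \<open>\<i>\<close> times a difference of components
  of \<open>h\<close> and \<open>k\<close>, so its holomorphy needs no computation with partial derivatives.
\<close>
lemma stem_holo_of_two_slices:
  assumes J: "J \<in> imag_units" "slice_holo J D h" and K: "K \<in> imag_units" "slice_holo K D k"
  shows "stem_holo D (\<lambda>z. a * (J * h z - K * k z)) (\<lambda>z. a * (h z - k z))"
  unfolding stem_holo_def
proof
  fix v
  let ?w = "q_conj a * v"
  have "(\<lambda>z. \<i> * (slice_comp J ?w (h z) - slice_comp K ?w (k z))) holomorphic_on D"
    using J K unfolding slice_holo_def by (intro holomorphic_intros) auto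
  moreover have "Complex ((a * (J * h z - K * k z)) \<bullet> v) ((a * (h z - k z)) \<bullet> v)
      = \<i> * (slice_comp J ?w (h z) - slice_comp K ?w (k z))" for z
    by (simp add: slice_comp_def complex_eq_iff inner_diff_left flip: inner_mult_left_adjoint)
       (simp add: ring_distribs inner_diff_left)
  ultimately show "(\<lambda>z. Complex ((a * (J * h z - K * k z)) \<bullet> v) ((a * (h z - k z)) \<bullet> v)) holomorphic_on D"
    by simp
qed

text \<open>
  The values at two distinct imaginary units \<open>J\<close>, \<open>K\<close> determine \<open>b\<close> and \<open>c\<close> in \<open>b + I * c\<close>, and any
  two values \<open>h\<close>, \<open>k\<close> at these units are attained by such an expression. The proof rests on
  \<open>J * (J - K) = - ((J - K) * K)\<close>.
\<close>
lemma two_unit_formula: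
  assumes J: "J \<in> imag_units" and K: "K \<in> imag_units" and "J \<noteq> K"
  defines "a \<equiv> inverse (J - K)"
  shows "a * (J * (b + J * c) - K * (b + K * c)) = b" "a * ((b + J * c) - (b + K * c)) = c"
    "a * (J * h - K * k) + J * (a * (h - k)) = h"
    "a * (J * h - K * k) + K * (a * (h - k)) = k"
proof -
  have a: "a * (J - K) = 1" "(J - K) * a = 1"
    using \<open>J \<noteq> K\<close> by (simp_all add: a_def)
  have "a * (J * (b + J * c) - K * (b + K * c)) = (a * (J - K)) * b"
    by (simp add: ring_distribs imag_units_square_assoc J K mult.assoc)
  then show "a * (J * (b + J * c) - K * (b + K * c)) = b" by (simp add: a)
  have "a * ((b + J * c) - (b + K * c)) = (a * (J - K)) * c"
    by (simp add: algebra_simps)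
  then show "a * ((b + J * c) - (b + K * c)) = c" by (simp add: a)
  have "J * (J - K) = - ((J - K) * K)"
    by (simp add: algebra_simps imag_units_square J K)
  then have "a * (J * (J - K)) * a = a * (- ((J - K) * K)) * a"
    by simp
  then have "(a * J) * ((J - K) * a) = - ((a * (J - K)) * (K * a))"
    by (simp only: mult.assoc mult_minus_left mult_minus_right)
  then have aJ: "a * J = - (K * a)"
    by (simp add: a)
  have "K * (J - K) = - ((J - K) * J)"
    by (simp add: algebra_simps imag_units_square J K)
  then have "a * (K * (J - K)) * a = a * (- ((J - K) * J)) * a"
    by simp
  then have "(a * K) * ((J - K) * a) = - ((a * (J - K)) * (J * a))"
    by (simp only: mult.assoc mult_minus_left mult_minus_right)
  then have aK: "a * K = - (J * a)"
    by (simp add: a)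
  have Ja: "J * a = - (a * K)" by (simp add: aK)
  have "a * (J * h - K * k) + J * (a * (h - k)) = (a * J) * h - (a * K) * k + (J * a) * h - (J * a) * k"
    by (simp add: algebra_simps)
  also have "\<dots> = (a * J) * h + (J * a) * h" by (simp add: aK)
  also have "\<dots> = (a * (J - K)) * h"
    unfolding Ja by (simp add: algebra_simps)
  finally show "a * (J * h - K * k) + J * (a * (h - k)) = h" by (simp add: a)
  have "a * (J * h - K * k) + K * (a * (h - k)) = (a * J) * h - (a * K) * k + (K * a) * h - (K * a) * k"
    by (simp add: algebra_simps)
  also have "\<dots> = (a * J) * k - (a * K) * k" by (simp add: aJ)
  also have "\<dots> = (a * (J - K)) * k" by (simp add: algebra_simps)
  finally show "a * (J * h - K * k) + K * (a * (h - k)) = k" by (simp add: a)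
qed

section \<open>Local stems of slice regular functions\<close>

text \<open>
  Near the slice point \<open>(z0, I0)\<close>, the function \<open>f\<close> is induced by the holomorphic stem \<open>(b, c)\<close>
  simultaneously on all slices close to that of \<open>I0\<close>. The point is a pair of a complex number and a
  unit, so that real points are covered as well.
\<close>
definition local_stem ::
  "quat set \<Rightarrow> (quat \<Rightarrow> quat) \<Rightarrow> complex \<Rightarrow> quat \<Rightarrow> real \<Rightarrow> (complex \<Rightarrow> quat) \<Rightarrow> (complex \<Rightarrow> quat) \<Rightarrow> bool"
  where
  "local_stem \<Omega> f z0 I0 \<epsilon> b c \<longleftrightarrow> \<epsilon> > 0 \<and> stem_holo (ball z0 \<epsilon>) b c \<and>
     (\<forall>z I. dist z0 z < \<epsilon> \<longrightarrow> I \<in> imag_units \<longrightarrow> dist I I0 < \<epsilon> \<longrightarrow>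
        slice_pt z I \<in> \<Omega> \<and> f (slice_pt z I) = b z + I * c z)"

text \<open>
  The stem interpolating \<open>f\<close> on two slices is defined on the whole ball. It agrees with \<open>f\<close> on
  every nearby slice as soon as it does so on a set \<open>Z\<close> with a limit point in the ball, by the identity
  principle on that slice. The agreement then holds over the whole ball; only the range of admissible
  units is limited by \<open>\<epsilon>\<close>.
\<close>
lemma local_stem_extend:
  assumes "open \<Omega>" "slice_regular \<Omega> f" and "0 < \<epsilon>" "\<epsilon> \<le> r" and I0: "I0 \<in> imag_units"
    and tube: "\<And>w J. dist z0 w < r \<Longrightarrow> dist J I0 < r \<Longrightarrow> slice_pt w J \<in> \<Omega>"
    and Z: "Z \<subseteq> ball z0 r" "\<zeta> \<in> ball z0 r" "\<zeta> islimpt Z"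
    and on_Z: "\<And>z I. z \<in> Z \<Longrightarrow> I \<in> imag_units \<Longrightarrow> dist I I0 < \<epsilon> \<Longrightarrow> f (slice_pt z I) = b0 z + I * c0 z"
    and z: "z \<in> ball z0 r"
  shows "\<exists>\<epsilon> b c. local_stem \<Omega> f z I0 \<epsilon> b c"
proof -
  obtain K where K: "K \<in> imag_units" "K \<noteq> I0" "dist K I0 < \<epsilon>"
    using imag_units_near[OF I0 \<open>0 < \<epsilon>\<close>] by blast
  have slice: "slice_holo I (ball z0 r) (\<lambda>z. f (slice_pt z I))" if "I \<in> imag_units" "dist I I0 < r" for I
  proof -
    have "ball z0 r \<subseteq> {z. slice_pt z I \<in> \<Omega>}"
      using tube that by auto
    then show ?thesis
      using slice_regular_imp_slice_holo[OF assms(1,2) that(1)] holomorphic_on_subset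
      unfolding slice_holo_def by blast
  qed
  define a where "a = inverse (I0 - K)"
  define b where "b z = a * (I0 * f (slice_pt z I0) - K * f (slice_pt z K))" for z
  define c where "c z = a * (f (slice_pt z I0) - f (slice_pt z K))" for z
  have stem: "stem_holo (ball z0 r) b c"
    unfolding b_def c_def using I0 K assms(3,4)
    by (intro stem_holo_of_two_slices slice) auto
  have rep: "f (slice_pt w I) = b w + I * c w" if I: "I \<in> imag_units" "dist I I0 < \<epsilon>" and w: "w \<in> ball z0 r" for I w
  proof -
    have "slice_holo I (ball z0 r) (\<lambda>z. f (slice_pt z I) - (b z + I * c z))"
      using I assms(4) by (intro slice_holo_diff slice stem_holo_imp_slice_holo[OF stem]) auto
    moreover have "f (slice_pt z I) - (b z + I * c z) = 0" if "z \<in> Z" for z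
    proof -
      have "f (slice_pt z I0) = b0 z + I0 * c0 z" "f (slice_pt z K) = b0 z + K * c0 z"
        using on_Z[OF that] I0 K assms(3) by auto
      then have "b z = b0 z" "c z = c0 z"
        using two_unit_formula(1,2)[OF I0 K(1)] K(2) by (auto simp: b_def c_def a_def)
      then show ?thesis
        using on_Z[OF that I] by simp
    qed
    ultimately have "f (slice_pt w I) - (b w + I * c w) = 0"
      using slice_holo_eq_0[OF _ open_ball connected_ball Z _ w, of I "\<lambda>z. f (slice_pt z I) - (b z + I * c z)"]
      by blast
    then show ?thesis by simp
  qed
  define \<delta> where "\<delta> = min \<epsilon> (r - dist z0 z)"
  have sub: "ball z \<delta> \<subseteq> ball z0 r"
  proof
    fix w assume "w \<in> ball z \<delta>"
    then show "w \<in> ball z0 r"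
      using dist_triangle[of z0 w z] by (simp add: \<delta>_def)
  qed
  have "local_stem \<Omega> f z I0 \<delta> b c"
    unfolding local_stem_def
  proof (intro conjI allI impI)
    show "\<delta> > 0" using z \<open>0 < \<epsilon>\<close> by (simp add: \<delta>_def)
    show "stem_holo (ball z \<delta>) b c" using stem sub by (rule stem_holo_subset)
    fix w I assume "dist z w < \<delta>" and I: "I \<in> imag_units" "dist I I0 < \<delta>"
    then have "w \<in> ball z0 r" using sub by auto
    moreover have "dist I I0 < \<epsilon>" using I by (simp add: \<delta>_def)
    ultimately show "slice_pt w I \<in> \<Omega>" "f (slice_pt w I) = b w + I * c w"
      using rep tube I \<open>\<epsilon> \<le> r\<close> by auto
  qed
  then show ?thesis by blast
qed

lemma connected_slice_preimage:
  assumes \<Omega>: "slice_domain \<Omega>" and I: "I \<in> imag_units"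
  shows "connected {z. slice_pt z I \<in> \<Omega>}"
proof -
  have "\<Omega> \<inter> slice_plane I = (\<lambda>z. slice_pt z I) ` {z. slice_pt z I \<in> \<Omega>}"
    by (auto simp: slice_plane_iff)
  then have "slice_coord I ` (\<Omega> \<inter> slice_plane I) = {z. slice_pt z I \<in> \<Omega>}"
    by (simp add: image_image slice_coord_slice_pt[OF I])
  moreover have "connected (slice_coord I ` (\<Omega> \<inter> slice_plane I))"
    using \<Omega> I by (intro connected_continuous_image continuous_on_slice_coord) (simp add: slice_domain_def)
  ultimately show ?thesis by simp
qed

text \<open>
  A slice regular function on a slice domain has a local stem at every point. At a real point the
  interpolating stem agrees with \<open>f\<close> on the real axis, which is common to all slices. From there the
  property spreads over the connected slice of the domain, since \<open>local_stem_extend\<close> makes it both an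
  open and a closed condition.
\<close>
theorem local_stem_exists:
  assumes \<Omega>: "slice_domain \<Omega>" "slice_regular \<Omega> f" and I: "I \<in> imag_units" and z: "slice_pt z I \<in> \<Omega>"
  obtains \<epsilon> b c where "local_stem \<Omega> f z I \<epsilon> b c"
proof -
  have op: "open \<Omega>"
    using \<Omega>(1) by (simp add: slice_domain_def)
  define D where "D = {z. slice_pt z I \<in> \<Omega>}"
  define P where "P z \<longleftrightarrow> (\<exists>\<epsilon> b c. local_stem \<Omega> f z I \<epsilon> b c)" for z
  have conn: "connected D"
    using connected_slice_preimage[OF \<Omega>(1) I] by (simp add: D_def)
  obtain x where x: "of_real x \<in> \<Omega>"
    using \<Omega>(1) by (auto simp: slice_domain_def Reals_def)
  then have xD: "of_real x \<in> D"
    by (simp add: D_def flip: of_real_eq_slice_pt)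
  have "P (of_real x)"
  proof -
    obtain r where r: "r > 0" "\<And>w J. dist (of_real x) w < r \<Longrightarrow> dist J I < r \<Longrightarrow> slice_pt w J \<in> \<Omega>"
      using slice_tube[OF op, of "of_real x" I] xD unfolding D_def by blast
    show ?thesis
      unfolding P_def
    proof (rule local_stem_extend[OF op \<Omega>(2) r(1) order_refl I r(2)])
      let ?Z = "complex_of_real ` {x<..<x + r}"
      show "?Z \<subseteq> ball (of_real x) r" by (auto simp: dist_norm simp flip: of_real_diff)
      show "complex_of_real x islimpt ?Z"
      proof (subst islimpt_approachable, safe)
        fix e :: real assume "e > 0"
        define t where "t = x + min e r / 2"
        have "t \<in> {x<..<x + r}" "\<bar>t - x\<bar> < e" using \<open>e > 0\<close> \<open>r > 0\<close> by (auto simp: t_def)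
        then show "\<exists>y\<in>?Z. y \<noteq> of_real x \<and> dist y (of_real x) < e"
          by (intro bexI[of _ "of_real t"]) (auto simp: dist_norm simp flip: of_real_diff)
      qed
      show "f (slice_pt z J) = f (of_real (Re z)) + J * 0" if "z \<in> ?Z" for z J
        using that by (auto simp: slice_pt_eq)
    qed (use r in auto)
  qed
  have "P z"
  proof (rule connected_induction_simple[OF conn xD, of z P])
    show "P (of_real x)" by fact
    show "z \<in> D" using z by (simp add: D_def)
    fix w assume "w \<in> D"
    then obtain r where r: "r > 0" "\<And>v J. dist w v < r \<Longrightarrow> dist J I < r \<Longrightarrow> slice_pt v J \<in> \<Omega>"
      using slice_tube[OF op, of w I] unfolding D_def by blast
    show "\<exists>T. openin (top_of_set D) T \<and> w \<in> T \<and> (\<forall>x\<in>T. \<forall>y\<in>T. P x \<longrightarrow> P y)"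
    proof (intro exI[of _ "D \<inter> ball w r"] conjI ballI impI)
      show "openin (top_of_set D) (D \<inter> ball w r)" by (simp add: openin_open_Int)
      show "w \<in> D \<inter> ball w r" using \<open>w \<in> D\<close> \<open>r > 0\<close> by simp
      fix u v assume u: "u \<in> D \<inter> ball w r" and v: "v \<in> D \<inter> ball w r" and "P u"
      then obtain \<epsilon> b c where st: "local_stem \<Omega> f u I \<epsilon> b c" by (auto simp: P_def)
      then have "\<epsilon> > 0" by (simp add: local_stem_def)
      show "P v"
        unfolding P_def
      proof (rule local_stem_extend[OF op \<Omega>(2) _ _ I r(2)])
        let ?Z = "ball w r \<inter> ball u \<epsilon>"
        show "u islimpt ?Z" using u \<open>\<epsilon> > 0\<close> by (intro interior_limit_point) (auto simp: interior_open)
        show "f (slice_pt z J) = b z + J * c z" if "z \<in> ?Z" "J \<in> imag_units" "dist J I < min \<epsilon> r" for z J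
          using st that by (simp add: local_stem_def)
      qed (use u v \<open>\<epsilon> > 0\<close> \<open>r > 0\<close> in auto)
    qed
  qed
  then show thesis using that by (auto simp: P_def)
qed

lemma local_stem_move:
  assumes st: "local_stem \<Omega> f z I \<epsilon> b c" and "dist z w < \<epsilon>" "dist J I < \<epsilon>"
  shows "local_stem \<Omega> f w J (min (\<epsilon> - dist z w) (\<epsilon> - dist J I)) b c"
  unfolding local_stem_def
proof (intro conjI allI impI)
  let ?\<delta> = "min (\<epsilon> - dist z w) (\<epsilon> - dist J I)"
  have sub: "dist z v < \<epsilon>" if "dist w v < ?\<delta>" for v
    using that dist_triangle[of z v w] by simp
  show "stem_holo (ball w ?\<delta>) b c"
    using st sub by (auto simp: local_stem_def intro!: stem_holo_subset[of "ball z \<epsilon>"])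
  fix v K assume "dist w v < ?\<delta>" "K \<in> imag_units" "dist K J < ?\<delta>"
  then have "dist z v < \<epsilon>" "dist K I < \<epsilon>"
    using sub dist_triangle[of K I J] by auto
  then show "slice_pt v K \<in> \<Omega>" "f (slice_pt v K) = b v + K * c v"
    using st \<open>K \<in> imag_units\<close> by (auto simp: local_stem_def)
qed (use assms in auto)

lemma local_stem_center:
  assumes "local_stem \<Omega> f z I \<epsilon> b c" "I \<in> imag_units"
  shows "slice_pt z I \<in> \<Omega>" "f (slice_pt z I) = b z + I * c z"
  using assms by (auto simp: local_stem_def)

lemma local_stem_real:
  assumes st: "local_stem \<Omega> f z I \<epsilon> b c" and I: "I \<in> imag_units" and "Im z = 0"
  shows "c z = 0"
proof -
  obtain K where K: "K \<in> imag_units" "K \<noteq> I" "dist K I < \<epsilon>"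
    using imag_units_near[OF I] st by (auto simp: local_stem_def)
  have eq: "slice_pt z K = slice_pt z I"
    using \<open>Im z = 0\<close> by (simp add: slice_pt_eq)
  have val: "f (slice_pt z J) = b z + J * c z" if "J \<in> imag_units" "dist J I < \<epsilon>" for J
    using st that by (simp add: local_stem_def)
  have "b z + I * c z = b z + K * c z"
    using val[OF I] val[OF K(1,3)] K(2) eq st by (simp add: local_stem_def)
  then have "(I - K) * c z = 0" by (simp add: algebra_simps)
  then show ?thesis using K by simp
qed

lemma local_stems_imp_slice_regular:
  assumes "open \<Omega>"
    and st: "\<And>z I. I \<in> imag_units \<Longrightarrow> slice_pt z I \<in> \<Omega> \<Longrightarrow> \<exists>\<epsilon> b c. local_stem \<Omega> f z I \<epsilon> b c"
  shows "slice_regular \<Omega> f"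
proof (rule slice_holo_imp_slice_regular[OF assms(1)])
  fix I assume I: "I \<in> imag_units"
  define D where "D = {z. slice_pt z I \<in> \<Omega>}"
  have "(\<lambda>z. slice_comp I v (f (slice_pt z I))) field_differentiable (at z within D)" if zD: "z \<in> D" for z v
  proof -
    obtain \<epsilon> b c where bc: "local_stem \<Omega> f z I \<epsilon> b c"
      using st[OF I] zD unfolding D_def by blast
    then have "(\<lambda>w. slice_comp I v (b w + I * c w)) holomorphic_on ball z \<epsilon>"
      using stem_holo_imp_slice_holo I by (simp add: local_stem_def slice_holo_def)
    then have "(\<lambda>w. slice_comp I v (f (slice_pt w I))) holomorphic_on ball z \<epsilon>"
      by (rule holomorphic_transform) (use bc I in \<open>auto simp: local_stem_def\<close>)
    then show ?thesis
      using bc holomorphic_on_imp_differentiable_at[of _ "ball z \<epsilon>" z]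
      by (auto simp: local_stem_def intro: field_differentiable_at_within)
  qed
  then have "(\<lambda>z. slice_comp I v (f (slice_pt z I))) holomorphic_on D" for v
    by (simp add: holomorphic_on_def)
  then show "slice_holo I {z. slice_pt z I \<in> \<Omega>} (\<lambda>z. f (slice_pt z I))"
    by (simp add: slice_holo_def D_def)
qed

section \<open>Spherical values and derivatives\<close>

lemma dist_slice_pt: "dist (slice_pt z I) (slice_pt z J) = \<bar>Im z\<bar> * dist I J"
proof -
  have "slice_pt z I - slice_pt z J = Im z *\<^sub>R (I - J)"
    by (simp add: slice_pt_eq algebra_simps)
  then show ?thesis
    by (simp add: dist_norm)
qed

lemma qsphere_eq: "qsphere x y = {slice_pt (Complex x y) J | J. J \<in> imag_units}"
  by (simp add: qsphere_def qpt_eq_slice_pt)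

text \<open>
  It suffices to know the affine representation at the units in a ball around \<open>J\<close>. Uniqueness of the
  pair holds because every neighbourhood in the sphere contains a second unit.
\<close>
lemma spherical_pair_eqI:
  assumes J: "J \<in> imag_units" and "Im z > 0" "\<epsilon> > 0"
    and f: "\<And>I. I \<in> imag_units \<Longrightarrow> dist I J < \<epsilon> \<Longrightarrow> slice_pt z I \<in> \<Omega> \<and> f (slice_pt z I) = b + I * c"
  shows "spherical_pair \<Omega> f (slice_pt z J) = (b, c)"
proof -
  let ?q = "slice_pt z J"
  define y where "y = Im z"
  define Sp where "Sp = qsphere (Re z) y"
  have y: "y > 0" using assms by (simp add: y_def)
  have Sp: "Sp = {slice_pt z I | I. I \<in> imag_units}"
    by (simp add: Sp_def qsphere_eq y_def)
  define P where "P = (\<lambda>(b, c). \<exists>U. openin (top_of_set Sp) U \<and> ?q \<in> U \<and> U \<subseteq> \<Omega> \<and>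
        (\<forall>I\<in>imag_units. slice_pt z I \<in> U \<longrightarrow> f (slice_pt z I) = b + I * c))"
  have dist: "dist (slice_pt z I) ?q = y * dist I J" for I
    using y by (simp add: dist_slice_pt y_def)
  have pair: "spherical_pair \<Omega> f ?q = The P"
    using y J by (simp add: spherical_pair_def Let_def slice_pt_coords(1,3,5) P_def Sp_def y_def qpt_eq_slice_pt)
  have "The P = (b, c)"
  proof (rule the_equality)
    show "P (b, c)"
      unfolding P_def prod.case
    proof (intro exI[of _ "Sp \<inter> ball ?q (y * \<epsilon>)"] conjI ballI impI)
      have near: "I \<in> imag_units \<Longrightarrow> slice_pt z I \<in> ball ?q (y * \<epsilon>) \<Longrightarrow> dist I J < \<epsilon>" for I
        using dist[of I] y by (simp add: dist_commute)
      show "openin (top_of_set Sp) (Sp \<inter> ball ?q (y * \<epsilon>))" by (simp add: openin_open_Int)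
      show "?q \<in> Sp \<inter> ball ?q (y * \<epsilon>)" using J y \<open>\<epsilon> > 0\<close> by (auto simp: Sp)
      show "Sp \<inter> ball ?q (y * \<epsilon>) \<subseteq> \<Omega>" using near f by (auto simp: Sp)
      show "f (slice_pt z I) = b + I * c" if "I \<in> imag_units" "slice_pt z I \<in> Sp \<inter> ball ?q (y * \<epsilon>)" for I
        using near f that by auto
    qed
  next
    fix u assume "P u"
    obtain b' c' where u: "u = (b', c')" by (cases u)
    obtain U where U: "openin (top_of_set Sp) U" "?q \<in> U"
      and f': "\<And>I. I \<in> imag_units \<Longrightarrow> slice_pt z I \<in> U \<Longrightarrow> f (slice_pt z I) = b' + I * c'"
      using \<open>P u\<close> by (auto simp: P_def u)
    then obtain \<delta> where \<delta>: "\<delta> > 0" "ball ?q \<delta> \<inter> Sp \<subseteq> U"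
      by (meson openin_contains_ball)
    obtain K where K: "K \<in> imag_units" "K \<noteq> J" "dist K J < min \<epsilon> (\<delta> / y)"
      using imag_units_near[OF J, of "min \<epsilon> (\<delta> / y)"] \<open>\<epsilon> > 0\<close> \<delta> y by auto
    have "slice_pt z K \<in> ball ?q \<delta> \<inter> Sp"
      using K y dist[of K] by (auto simp: Sp dist_commute field_simps)
    then have "b + J * c = b' + J * c'" "b + K * c = b' + K * c'"
      using f'[OF J] f'[OF K(1)] f[OF J] f[OF K(1)] K \<delta> U \<open>\<epsilon> > 0\<close> by auto
    then show "u = (b, c)"
      using two_unit_formula(1,2)[OF J K(1)] K(2) u by metis
  qed
  then show ?thesis by (simp add: pair)
qed

text \<open>
  Dividing by \<open>Im z\<close> rather than by its absolute value makes the formula for the derivative valid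
  in both half planes: the pair at \<open>(cnj z, - I)\<close> is \<open>(b z, - c z)\<close>.
\<close>
lemma local_stem_spherical:
  assumes st: "local_stem \<Omega> f z I \<epsilon> b c" and I: "I \<in> imag_units" and "Im z \<noteq> 0"
  shows "spherical_value \<Omega> f (slice_pt z I) = b z"
    "spherical_deriv \<Omega> f (slice_pt z I) = inverse (Im z) *\<^sub>R c z"
proof -
  have st': "\<epsilon> > 0" "\<And>J. J \<in> imag_units \<Longrightarrow> dist J I < \<epsilon> \<Longrightarrow>
      slice_pt z J \<in> \<Omega> \<and> f (slice_pt z J) = b z + J * c z"
    using st by (auto simp: local_stem_def)
  have "spherical_pair \<Omega> f (slice_pt z I) = (b z, sgn (Im z) *\<^sub>R c z)"
  proof (cases "Im z > 0")
    case True
    then show ?thesis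
      using spherical_pair_eqI[OF I True st'] by simp
  next
    case False
    then have neg: "Im (cnj z) > 0" using \<open>Im z \<noteq> 0\<close> by simp
    have "slice_pt (cnj z) J \<in> \<Omega> \<and> f (slice_pt (cnj z) J) = b z + J * (- c z)"
      if "J \<in> imag_units" "dist J (- I) < \<epsilon>" for J
    proof -
      have "dist (- J) I < \<epsilon>"
        using that by (metis dist_minus minus_minus)
      moreover have "slice_pt (cnj z) J = slice_pt z (- J)"
        by (simp add: slice_pt_eq)
      ultimately show ?thesis
        using st'(2)[of "- J"] that imag_units_uminus by simp
    qed
    from spherical_pair_eqI[OF imag_units_uminus[OF I] neg st'(1) this]
    show ?thesis
      using neg by (simp add: slice_pt_cnj_uminus)
  qed
  moreover have "inverse \<bar>y\<bar> * sgn y = inverse y" for y :: real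
    by (simp add: sgn_if)
  ultimately show "spherical_value \<Omega> f (slice_pt z I) = b z"
    "spherical_deriv \<Omega> f (slice_pt z I) = inverse (Im z) *\<^sub>R c z"
    using \<open>Im z \<noteq> 0\<close> by (simp_all add: spherical_value_def spherical_deriv_def slice_pt_coords(1,3,5)[OF I])
qed

section \<open>Multiplication and division of stems\<close>

text \<open>
  The two components of the product of \<open>b + \<iota> c\<close> with the complex scalar \<open>n\<close>, whose imaginary unit
  is identified with \<open>\<iota>\<close>.
\<close>
definition stem_re :: "complex \<Rightarrow> quat \<Rightarrow> quat \<Rightarrow> quat" where
  "stem_re n b c = Re n *\<^sub>R b - Im n *\<^sub>R c"

definition stem_im :: "complex \<Rightarrow> quat \<Rightarrow> quat \<Rightarrow> quat" where
  "stem_im n b c = Re n *\<^sub>R c + Im n *\<^sub>R b"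

lemma stem_eval:
  assumes "I \<in> imag_units"
  shows "stem_re n b c + I * stem_im n b c = slice_pt n I * (b + I * c)"
  by (simp add: stem_re_def stem_im_def slice_pt_eq algebra_simps imag_units_square_assoc[OF assms] of_real_def)

lemma stem_comp_scale:
  "Complex (stem_re n b c \<bullet> v) (stem_im n b c \<bullet> v) = n * Complex (b \<bullet> v) (c \<bullet> v)"
  by (simp add: stem_re_def stem_im_def complex_eq_iff inner_add_left inner_diff_left)

lemma stem_holo_scale:
  assumes "stem_holo D b c" "n holomorphic_on D"
  shows "stem_holo D (\<lambda>z. stem_re (n z) (b z) (c z)) (\<lambda>z. stem_im (n z) (b z) (c z))"
  using assms unfolding stem_holo_def stem_comp_scale by (auto intro: holomorphic_intros)

lemma stem_holo_linear_factor:
  assumes "stem_holo D b c"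
  shows "stem_holo D (\<lambda>z. stem_re z (b z) (c z) - a * b z) (\<lambda>z. stem_im z (b z) (c z) - a * c z)"
proof -
  have "Complex ((stem_re z b c - a * b) \<bullet> v) ((stem_im z b c - a * c) \<bullet> v) =
      z * Complex (b \<bullet> v) (c \<bullet> v) - Complex (b \<bullet> (q_conj a * v)) (c \<bullet> (q_conj a * v))" for z b c v
    by (simp add: complex_eq_iff inner_diff_left inner_mult_left_adjoint flip: stem_comp_scale)
  then show ?thesis
    using assms unfolding stem_holo_def by (auto intro!: holomorphic_intros)
qed

lemma stem_holo_continuous_on:
  assumes "stem_holo D b c"
  shows "continuous_on D b" "continuous_on D c"
proof -
  have "continuous_on D (\<lambda>z. Complex (b z \<bullet> v) (c z \<bullet> v))" for v
    using assms holomorphic_on_imp_continuous_on by (auto simp: stem_holo_def)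
  then have "continuous_on D (\<lambda>z. b z \<bullet> v)" "continuous_on D (\<lambda>z. c z \<bullet> v)" for v
    using continuous_on_Re continuous_on_Im by fastforce+
  then show "continuous_on D b" "continuous_on D c"
    by (subst continuous_on_componentwise; blast)+
qed

lemma eq_at_puncture:
  fixes b b' :: "complex \<Rightarrow> 'a :: t2_space"
  assumes "continuous_on D b" "continuous_on D b'" "open D" "a \<in> D"
    and "\<And>z. z \<in> D \<Longrightarrow> z \<noteq> a \<Longrightarrow> b z = b' z"
  shows "b a = b' a"
proof -
  have "b \<midarrow>a\<rightarrow> b a" "b' \<midarrow>a\<rightarrow> b' a"
    using assms by (auto simp: continuous_on_eq_continuous_at isCont_def)
  moreover have "eventually (\<lambda>z. b z = b' z) (at a)"
    using eventually_at_in_open[OF assms(3,4)] by eventually_elim (use assms(5) in auto)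
  ultimately show ?thesis
    using LIM_unique tendsto_cong by blast
qed

text \<open>
  A simple pole of the scalar factor is cancelled by a zero of the stem. The removable singularity
  theorem applies to each component.
\<close>
lemma stem_holo_removable:
  assumes st: "stem_holo D b c" and D: "open D" "a \<in> D" and "b a = 0" "c a = 0"
    and m: "m holomorphic_on D" and n: "\<And>z. z \<in> D \<Longrightarrow> z \<noteq> a \<Longrightarrow> n z = m z / (z - a)"
  obtains B C where "stem_holo D B C"
    "\<And>z. z \<in> D \<Longrightarrow> z \<noteq> a \<Longrightarrow> B z = stem_re (n z) (b z) (c z) \<and> C z = stem_im (n z) (b z) (c z)"
proof -
  define \<psi> where "\<psi> v z = Complex (b z \<bullet> v) (c z \<bullet> v)" for v z
  define \<Psi> where "\<Psi> v z = m z * (if z = a then deriv (\<psi> v) a else (\<psi> v z - \<psi> v a) / (z - a))" for v z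
  have \<psi>a: "\<psi> v a = 0" for v
    by (simp add: \<psi>_def assms complex_eq_iff)
  have \<psi>: "\<psi> v holomorphic_on D" for v
    using st by (simp add: stem_holo_def \<psi>_def[abs_def])
  have \<Psi>: "\<Psi> v holomorphic_on D" for v
    unfolding \<Psi>_def using D by (intro holomorphic_on_mult[OF m] pole_lemma[OF \<psi>]) (simp add: interior_open)
  define B where "B z = (\<Sum>v\<in>Basis. Re (\<Psi> v z) *\<^sub>R v)" for z
  define C where "C z = (\<Sum>v\<in>Basis. Im (\<Psi> v z) *\<^sub>R v)" for z
  have "Complex (B z \<bullet> v) (C z \<bullet> v) = (\<Sum>e\<in>Basis. \<Psi> e z * of_real (e \<bullet> v))" for z v
    by (simp add: B_def C_def complex_eq_iff inner_sum_left)
  then have "stem_holo D B C"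
    unfolding stem_holo_def using \<Psi> by (auto intro!: holomorphic_intros)
  moreover have "B z = stem_re (n z) (b z) (c z) \<and> C z = stem_im (n z) (b z) (c z)" if "z \<in> D" "z \<noteq> a" for z
  proof -
    have "Complex (stem_re (n z) (b z) (c z) \<bullet> v) (stem_im (n z) (b z) (c z) \<bullet> v) = \<Psi> v z" for v
      using that n[OF that] by (simp add: stem_comp_scale \<Psi>_def \<psi>a) (simp add: \<psi>_def)
    then have "stem_re (n z) (b z) (c z) \<bullet> v = Re (\<Psi> v z)" "stem_im (n z) (b z) (c z) \<bullet> v = Im (\<Psi> v z)" for v
      by (metis complex.sel)+
    then show ?thesis
      unfolding B_def C_def by (metis (no_types, lifting) euclidean_representation sum.cong)
  qed
  ultimately show thesis using that by blast
qed

text \<open>The regular product by \<open>q - p\<close> is multiplication of stems by \<open>z - p\<close>, evaluated at \<open>I\<close>.\<close>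
lemma regular_prod_linear_factor:
  assumes "open \<Omega>" and st: "local_stem \<Omega> g z I \<epsilon> b c" and I: "I \<in> imag_units"
  shows "regular_prod \<Omega> (\<lambda>q. q - p) g (slice_pt z I) =
    (stem_re z (b z) (c z) - p * b z) + I * (stem_im z (b z) (c z) - p * c z)"
proof (cases "Im z = 0")
  case True
  then have "regular_prod \<Omega> (\<lambda>q. q - p) g (slice_pt z I) = (slice_pt z I - p) * g (slice_pt z I)"
    by (simp add: regular_prod_def slice_pt_coords(5)[OF I])
  also have "\<dots> = (of_real (Re z) - p) * b z"
    using True local_stem_real[OF st I True] local_stem_center(2)[OF st I] by (simp add: slice_pt_eq)
  finally show ?thesis
    using True local_stem_real[OF st I True]
    by (simp add: stem_re_def stem_im_def left_diff_distrib scaleR_conv_of_real)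
next
  case False
  obtain r where r: "r > 0" "\<And>w J. dist z w < r \<Longrightarrow> dist J I < r \<Longrightarrow> slice_pt w J \<in> \<Omega>"
    using slice_tube[OF assms(1) local_stem_center(1)[OF st I]] by blast
  have "local_stem \<Omega> (\<lambda>q. q - p) z I r (\<lambda>z. of_real (Re z) - p) (\<lambda>z. of_real (Im z))"
    unfolding local_stem_def
  proof (intro conjI allI impI)
    have "Complex ((of_real (Re z) - p) \<bullet> v) (of_real (Im z) \<bullet> v) = z * of_real (q_re v) - of_real (p \<bullet> v)" for z v
      by (simp add: complex_eq_iff inner_diff_left) (simp add: inner_quat_def)
    then show "stem_holo (ball z r) (\<lambda>z. of_real (Re z) - p) (\<lambda>z. of_real (Im z))"
      unfolding stem_holo_def by (auto intro!: holomorphic_intros)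
  qed (use r in \<open>auto simp: slice_pt_eq of_real_def\<close>)
  note lin = local_stem_spherical[OF this I False]
  note g = local_stem_spherical[OF st I False]
  have [simp]: "inverse (Im z) *\<^sub>R (of_real (Im z) :: quat) = 1"
    using False by (simp add: of_real_def)
  have "(Im z *\<^sub>R I)\<^sup>2 = of_real (- (Im z)\<^sup>2)"
    by (simp add: power2_eq_square imag_units_square[OF I] of_real_def)
  then show ?thesis
    using False slice_pt_coords(5)[OF I]
    by (simp add: regular_prod_def lin g slice_pt_coords(2)[OF I] stem_re_def stem_im_def
        algebra_simps of_real_def power2_eq_square)
qed

text \<open>
  The product \<open>(z - p) (z - q_conj p)\<close> is the complex scalar \<open>(z - w) (z - cnj w)\<close>, so multiplication
  by \<open>z - p\<close> is inverted by \<open>z - q_conj p\<close> divided by that scalar.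
\<close>
lemma stem_linear_factor_conj:
  fixes b c p :: quat and z w :: complex
  assumes p: "p = slice_pt w I0" and I0: "I0 \<in> imag_units"
  defines "b2 \<equiv> stem_re z b c - q_conj p * b" and "c2 \<equiv> stem_im z b c - q_conj p * c"
  shows "stem_re z b2 c2 - p * b2 = stem_re ((z - w) * (z - cnj w)) b c"
    "stem_im z b2 c2 - p * c2 = stem_im ((z - w) * (z - cnj w)) b c"
proof -
  have "q_re I0 = 0" using I0 by (simp add: imag_units_iff)
  then have conj: "q_conj p = of_real (Re w) - Im w *\<^sub>R I0"
    by (simp add: p q_conj_def slice_pt_eq quat_eq_iff)
  have double: "(r * (s * 2)) *\<^sub>R q = (r * s) *\<^sub>R q + (r * s) *\<^sub>R q" for r s :: real and q :: quat
    by (simp flip: scaleR_left_distrib)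
  show "stem_re z b2 c2 - p * b2 = stem_re ((z - w) * (z - cnj w)) b c"
    "stem_im z b2 c2 - p * c2 = stem_im ((z - w) * (z - cnj w)) b c"
    unfolding b2_def c2_def conj unfolding p slice_pt_eq stem_re_def stem_im_def
    by (simp_all add: algebra_simps double of_real_def imag_units_square_assoc[OF I0])
qed

lemma stem_scale_linear_factor:
  "stem_re z (stem_re n b c) (stem_im n b c) - p * stem_re n b c
     = stem_re n (stem_re z b c - p * b) (stem_im z b c - p * c)"
  "stem_im z (stem_re n b c) (stem_im n b c) - p * stem_im n b c
     = stem_im n (stem_re z b c - p * b) (stem_im z b c - p * c)"
  by (simp_all add: stem_re_def stem_im_def algebra_simps)

lemma stem_scale_scale:
  "stem_re m (stem_re n b c) (stem_im n b c) = stem_re (m * n) b c"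
  "stem_im m (stem_re n b c) (stem_im n b c) = stem_im (m * n) b c"
  by (simp_all add: stem_re_def stem_im_def algebra_simps)

lemma stem_scale_1 [simp]: "stem_re 1 b c = b" "stem_im 1 b c = c"
  by (simp_all add: stem_re_def stem_im_def)

text \<open>
  Division of a stem by \<open>z - p\<close> near \<open>a\<close>. If \<open>a\<close> is a zero of the scalar \<open>(z - w) (z - cnj w)\<close>, the
  assumption on the values at \<open>a\<close> makes \<open>(z - q_conj p) (b + \<iota> c)\<close> vanish there, and the singularity is
  removable.
\<close>
lemma stem_division:
  assumes st: "stem_holo (ball a \<epsilon>) b c" "\<epsilon> > 0"
    and p: "p = slice_pt w I0" and I0: "I0 \<in> imag_units" and "Im w \<noteq> 0"
    and root: "a \<in> {w, cnj w} \<Longrightarrow> Im a *\<^sub>R b a = - (Im w *\<^sub>R (I0 * c a))"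
  defines "b2 \<equiv> \<lambda>z. stem_re z (b z) (c z) - q_conj p * b z"
    and "c2 \<equiv> \<lambda>z. stem_im z (b z) (c z) - q_conj p * c z"
    and "n \<equiv> \<lambda>z. inverse ((z - w) * (z - cnj w))"
  obtains \<delta> B C where "0 < \<delta>" "\<delta> \<le> \<epsilon>" "stem_holo (ball a \<delta>) B C"
    "\<And>z. z \<in> ball a \<delta> \<Longrightarrow> z \<noteq> a \<Longrightarrow> z \<notin> {w, cnj w}"
    "\<And>z. z \<in> ball a \<delta> \<Longrightarrow> z \<notin> {w, cnj w} \<Longrightarrow>
       B z = stem_re (n z) (b2 z) (c2 z) \<and> C z = stem_im (n z) (b2 z) (c2 z)"
    "\<And>z. z \<in> ball a \<delta> \<Longrightarrow> b z = stem_re z (B z) (C z) - p * B z \<and> c z = stem_im z (B z) (C z) - p * C z"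
proof -
  obtain d where d: "d > 0" "\<And>z. z \<in> {w, cnj w} \<Longrightarrow> z \<noteq> a \<Longrightarrow> d \<le> dist a z"
    using finite_set_avoid[of "{w, cnj w}" a] by auto
  define \<delta> where "\<delta> = min d \<epsilon>"
  have \<delta>: "0 < \<delta>" "\<delta> \<le> \<epsilon>" using d st by (auto simp: \<delta>_def)
  have away: "z \<notin> {w, cnj w}" if "z \<in> ball a \<delta>" "z \<noteq> a" for z
    using d(2)[of z] that by (auto simp: \<delta>_def)
  have st\<delta>: "stem_holo (ball a \<delta>) b c"
    using st \<delta> by (auto intro: stem_holo_subset)
  have st2: "stem_holo (ball a \<delta>) b2 c2"
    unfolding b2_def c2_def by (rule stem_holo_linear_factor[OF st\<delta>])
  obtain B C where BC: "stem_holo (ball a \<delta>) B C"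
    and eq: "\<And>z. z \<in> ball a \<delta> \<Longrightarrow> z \<notin> {w, cnj w} \<Longrightarrow>
       B z = stem_re (n z) (b2 z) (c2 z) \<and> C z = stem_im (n z) (b2 z) (c2 z)"
  proof (cases "a \<in> {w, cnj w}")
    case False
    have "n holomorphic_on ball a \<delta>"
      unfolding n_def using away False by (intro holomorphic_intros) auto
    from stem_holo_scale[OF st2 this] show thesis by (rule that) simp
  next
    case True
    have a: "Re a = Re w" "(Im a)\<^sup>2 = (Im w)\<^sup>2" "Im a \<noteq> 0"
      using True \<open>Im w \<noteq> 0\<close> by auto
    have n: "n z = inverse (z - cnj a) / (z - a)" for z
      using True by (auto simp: n_def field_simps)
    have "q_re I0 = 0" using I0 by (simp add: imag_units_iff)
    then have conj: "q_conj p = of_real (Re w) - Im w *\<^sub>R I0"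
      by (simp add: p q_conj_def slice_pt_eq quat_eq_iff)
    note r = root[OF True]
    have c2: "c2 a = 0"
      using r by (simp add: c2_def stem_im_def conj a algebra_simps of_real_def)
    have "Im a *\<^sub>R b2 a = I0 * (Im w *\<^sub>R (Im a *\<^sub>R b a)) - (Im a)\<^sup>2 *\<^sub>R c a"
      by (simp add: b2_def stem_re_def conj a(1) algebra_simps of_real_def power2_eq_square)
    also have "\<dots> = 0"
      unfolding r a(2) by (simp add: imag_units_square_assoc[OF I0] power2_eq_square)
    finally have b2: "b2 a = 0" using a by simp
    have "(\<lambda>z. inverse (z - cnj a)) holomorphic_on ball a \<delta>"
    proof (intro holomorphic_intros)
      fix z assume z: "z \<in> ball a \<delta>"
      \<comment> \<open>\<open>cnj a\<close> is the other zero of the scalar, which the ball avoids.\<close>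
      have "cnj a \<noteq> a" using a(3) by (simp add: complex_eq_iff)
      moreover have "cnj a \<in> {w, cnj w}" using True by auto
      ultimately show "z - cnj a \<noteq> 0" using away[OF z] by auto
    qed
    from stem_holo_removable[OF st2 _ _ b2 c2 this n] \<delta>(1)
    obtain B C where "stem_holo (ball a \<delta>) B C"
      "\<And>z. z \<in> ball a \<delta> \<Longrightarrow> z \<noteq> a \<Longrightarrow> B z = stem_re (n z) (b2 z) (c2 z) \<and> C z = stem_im (n z) (b2 z) (c2 z)"
      by (metis centre_in_ball open_ball)
    then show thesis using that True by blast
  qed
  let ?B2 = "\<lambda>z. stem_re z (B z) (C z) - p * B z" and ?C2 = "\<lambda>z. stem_im z (B z) (C z) - p * C z"
  have off: "b z = ?B2 z \<and> c z = ?C2 z" if "z \<in> ball a \<delta>" "z \<notin> {w, cnj w}" for z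
  proof -
    have "(z - w) * (z - cnj w) \<noteq> 0" using that by simp
    then have "n z * ((z - w) * (z - cnj w)) = 1" unfolding n_def by (rule left_inverse)
    moreover have "?B2 z = stem_re (n z * ((z - w) * (z - cnj w))) (b z) (c z)"
      "?C2 z = stem_im (n z * ((z - w) * (z - cnj w))) (b z) (c z)"
      using eq[OF that] unfolding stem_scale_scale[of "n z", symmetric]
      by (simp_all only: b2_def c2_def stem_scale_linear_factor stem_linear_factor_conj[OF p I0])
    ultimately show ?thesis by simp
  qed
  \<comment> \<open>At \<open>a\<close> the factorization follows by continuity.\<close>
  note cont = stem_holo_continuous_on[OF st\<delta>] stem_holo_continuous_on[OF stem_holo_linear_factor[OF BC]]
  have a: "a \<in> ball a \<delta>" using \<delta>(1) by simp
  have off': "b z = ?B2 z" "c z = ?C2 z" if "z \<in> ball a \<delta>" "z \<noteq> a" for z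
    using off[OF that(1) away[OF that]] by blast+
  have "b a = ?B2 a"
    by (rule eq_at_puncture[OF cont(1,3) open_ball a off'(1)])
  moreover have "c a = ?C2 a"
    by (rule eq_at_puncture[OF cont(2,4) open_ball a off'(2)])
  ultimately have "b z = ?B2 z \<and> c z = ?C2 z" if "z \<in> ball a \<delta>" for z
    using off'[OF that] by (cases "z = a") auto
  with that[OF \<delta> BC away eq] show thesis by blast
qed

section \<open>The regular quotient by a linear factor\<close>

lemma slice_pt_in_qsphere_iff:
  assumes I: "I \<in> imag_units"
  shows "slice_pt z I \<in> qsphere (Re w) (Im w) \<longleftrightarrow> z \<in> {w, cnj w}"
proof
  assume "slice_pt z I \<in> qsphere (Re w) (Im w)"
  then obtain J where J: "J \<in> imag_units" "slice_pt z I = slice_pt w J"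
    by (auto simp: qsphere_eq)
  then have "Re z = Re w" "\<bar>Im z\<bar> = \<bar>Im w\<bar>"
    using slice_pt_coords(1,3)[OF I, of z] slice_pt_coords(1,3)[OF J(1), of w] by auto
  then show "z \<in> {w, cnj w}"
    by (auto simp: complex_eq_iff)
next
  assume "z \<in> {w, cnj w}"
  then have "slice_pt z I = slice_pt w I \<or> slice_pt z I = slice_pt w (- I)"
    using slice_pt_cnj_uminus[of w "- I"] by auto
  then show "slice_pt z I \<in> qsphere (Re w) (Im w)"
    using I imag_units_uminus by (auto simp: qsphere_eq)
qed

lemma closed_qsphere: "Im w > 0 \<Longrightarrow> closed (qsphere (Re w) (Im w))"
proof -
  assume "Im w > 0"
  have "qsphere (Re w) (Im w) = {q. q_re q = Re w \<and> norm (q_Im q) = Im w}"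
  proof (intro equalityI subsetI)
    fix q assume "q \<in> qsphere (Re w) (Im w)"
    then show "q \<in> {q. q_re q = Re w \<and> norm (q_Im q) = Im w}"
      using \<open>Im w > 0\<close> by (auto simp: qsphere_eq slice_pt_coords(1,3))
  next
    fix q assume q: "q \<in> {q. q_re q = Re w \<and> norm (q_Im q) = Im w}"
    obtain z I where zI: "I \<in> imag_units" "q = slice_pt z I" "Im z \<ge> 0"
      by (rule slice_pt_exists)
    then have "z = w" using q by (simp add: slice_pt_coords(1,3) complex_eq_iff)
    then show "q \<in> qsphere (Re w) (Im w)"
      using zI by (auto simp: qsphere_eq)
  qed
  moreover have "closed {q. q_re q = Re w \<and> norm (q_Im q) = Im w}"
    unfolding q_Im_def of_real_def by (intro closed_Collect_conj closed_Collect_eq continuous_intros)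
  ultimately show ?thesis by simp
qed

text \<open>
  The exceptional set is \<open>\<O>\<close>, and \<open>w\<close> is the complex number in the upper half plane with
  \<open>p = slice_pt w I0\<close>.
\<close>

context
  fixes \<Omega> :: "quat set" and f :: "quat \<Rightarrow> quat" and p I0 :: quat and w :: complex and \<O> :: "quat set"
  assumes \<Omega>: "slice_domain \<Omega>" and f: "slice_regular \<Omega> f"
    and I0: "I0 \<in> imag_units" and w: "Im w > 0" and p: "p = slice_pt w I0"
  defines "\<O> \<equiv> {q \<in> qsphere (Re w) (Im w) \<inter> \<Omega>. spherical_value \<Omega> f q \<noteq> - q_Im p * spherical_deriv \<Omega> f q}"
begin

lemma open_domain: "open \<Omega>"
  using \<Omega> by (simp add: slice_domain_def)

text \<open>
  A point of \<open>\<Omega>\<close> on the sphere of \<open>p\<close> is not exceptional precisely when a stem of \<open>f\<close> at that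
  point satisfies the hypothesis \<open>root\<close> of \<open>stem_division\<close>.
\<close>
lemma exceptional_iff:
  assumes st: "local_stem \<Omega> f z I \<epsilon> b c" and I: "I \<in> imag_units"
  shows "slice_pt z I \<in> \<O> \<longleftrightarrow> z \<in> {w, cnj w} \<and> Im z *\<^sub>R b z \<noteq> - (Im w *\<^sub>R (I0 * c z))"
proof (cases "z \<in> {w, cnj w}")
  case True
  then have "Im z \<noteq> 0" using w by auto
  have "spherical_value \<Omega> f (slice_pt z I) = - q_Im p * spherical_deriv \<Omega> f (slice_pt z I) \<longleftrightarrow>
      Im z *\<^sub>R b z = Im z *\<^sub>R (- q_Im p * (inverse (Im z) *\<^sub>R c z))"
    unfolding local_stem_spherical[OF st I \<open>Im z \<noteq> 0\<close>] real_vector.scale_cancel_left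
    using \<open>Im z \<noteq> 0\<close> by blast
  also have "\<dots> \<longleftrightarrow> Im z *\<^sub>R b z = - (Im w *\<^sub>R (I0 * c z))"
    using \<open>Im z \<noteq> 0\<close> by (simp add: p slice_pt_coords(2)[OF I0] flip: mult.assoc)
  finally show ?thesis
    using True local_stem_center(1)[OF st I] slice_pt_in_qsphere_iff[OF I, of z w] by (auto simp: \<O>_def)
qed (use slice_pt_in_qsphere_iff[OF I, of z w] in \<open>auto simp: \<O>_def\<close>)

text \<open>
  On the sphere of \<open>p\<close> the spherical value and derivative are locally constant, so the exceptional
  set is closed in \<open>\<Omega>\<close>.
\<close>
lemma open_Diff_exceptional: "open (\<Omega> - \<O>)"
proof (subst open_subopen, safe)
  fix q assume q: "q \<in> \<Omega>" "q \<notin> \<O>"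
  show "\<exists>T. open T \<and> q \<in> T \<and> T \<subseteq> \<Omega> - \<O>"
  proof (cases "q \<in> qsphere (Re w) (Im w)")
    case False
    then show ?thesis
      using q open_domain closed_qsphere[OF w]
      by (intro exI[of _ "\<Omega> - qsphere (Re w) (Im w)"]) (auto simp: \<O>_def)
  next
    case True
    then obtain I where I: "I \<in> imag_units" "q = slice_pt w I" by (auto simp: qsphere_eq)
    then obtain \<epsilon> b c where st: "local_stem \<Omega> f w I \<epsilon> b c"
      using local_stem_exists[OF \<Omega> f I(1)] q by blast
    then have "\<epsilon> > 0" by (simp add: local_stem_def)
    have root: "Im w *\<^sub>R b w = - (Im w *\<^sub>R (I0 * c w))"
      using exceptional_iff[OF st I(1)] q I by auto
    have "q' \<notin> \<O>" if q': "q' \<in> ball q (Im w * \<epsilon>)" for q'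
    proof
      assume "q' \<in> \<O>"
      then obtain J where J: "J \<in> imag_units" "q' = slice_pt w J" by (auto simp: qsphere_eq \<O>_def)
      then have "dist J I < \<epsilon>"
        using q' w I by (simp add: dist_slice_pt dist_commute)
      then have "local_stem \<Omega> f w J (min (\<epsilon> - dist w w) (\<epsilon> - dist J I)) b c"
        using \<open>\<epsilon> > 0\<close> by (intro local_stem_move[OF st]) simp_all
      then show False
        using exceptional_iff J root \<open>q' \<in> \<O>\<close> by blast
    qed
    then show ?thesis
      using q open_domain w \<open>\<epsilon> > 0\<close> by (intro exI[of _ "\<Omega> \<inter> ball q (Im w * \<epsilon>)"]) auto
  qed
qed

text \<open>
  Each slice of the domain loses at most two nonreal points, so it stays connected, and all slices
  share a real point.
\<close>
lemma slice_domain_Diff_exceptional: "slice_domain (\<Omega> - \<O>)"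
proof -
  have real: "q \<notin> \<O>" if "q \<in> \<real>" for q
  proof
    assume "q \<in> \<O>"
    then obtain J where "J \<in> imag_units" "q = slice_pt w J" by (auto simp: qsphere_eq \<O>_def)
    then show False using that w slice_pt_coords(5) by auto
  qed
  obtain x where x: "of_real x \<in> \<Omega>"
    using \<Omega> by (auto simp: slice_domain_def Reals_def)
  then have x': "of_real x \<in> \<Omega> - \<O>" using real by simp
  have on_slice: "of_real x \<in> (\<Omega> - \<O>) \<inter> slice_plane I" for I
    using x' of_real_eq_slice_pt[of x I] by (auto simp: slice_plane_iff)
  have conn: "connected ((\<Omega> - \<O>) \<inter> slice_plane I)" if I: "I \<in> imag_units" for I
  proof -
    let ?D = "{z. slice_pt z I \<in> \<Omega>}" and ?E = "{z \<in> {w, cnj w}. slice_pt z I \<in> \<O>}"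
    have "connected (?D - ?E)"
      using open_slice_preimage[OF open_domain] connected_slice_preimage[OF \<Omega> I]
      by (intro connected_open_delete_finite) auto
    moreover have "?D - ?E = {z. slice_pt z I \<in> \<Omega> - \<O>}"
      using slice_pt_in_qsphere_iff[OF I, of _ w] unfolding \<O>_def by blast
    moreover have "(\<Omega> - \<O>) \<inter> slice_plane I = (\<lambda>z. slice_pt z I) ` {z. slice_pt z I \<in> \<Omega> - \<O>}"
      by (auto simp: slice_plane_iff)
    moreover have "continuous_on A (\<lambda>z. slice_pt z I)" for A
      by (intro continuous_intros)
    ultimately show ?thesis
      using connected_continuous_image by metis
  qed
  have "\<Omega> - \<O> = (\<Union>I\<in>imag_units. (\<Omega> - \<O>) \<inter> slice_plane I)"
    using slice_pt_exists by (auto simp: slice_plane_iff) metis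
  moreover have "connected (\<Union>I\<in>imag_units. (\<Omega> - \<O>) \<inter> slice_plane I)"
    using conn on_slice by (intro connected_Union) blast+
  ultimately have "connected (\<Omega> - \<O>)" by simp
  then show ?thesis
    unfolding slice_domain_def using x' on_slice conn open_Diff_exceptional
    by (auto simp: openin_open intro!: exI[of _ "\<Omega> - \<O>"])
qed

text \<open>
  The quotient away from the sphere of \<open>p\<close>: the regular product of \<open>q - q_conj p\<close> with \<open>f\<close>, divided by
  the value of \<open>(z - w) (z - cnj w)\<close>. At a real point \<open>q_Im q = 0\<close>, so the value of \<open>spherical_deriv\<close>
  does not matter there.
\<close>
definition quotient_off_sphere :: "quat \<Rightarrow> quat" where
  "quotient_off_sphere q = inverse (q\<^sup>2 - (2 * Re w) *\<^sub>R q + of_real ((cmod w)\<^sup>2)) *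
     (q * f q - q_conj p * spherical_value \<Omega> f q - q_Im q * q_conj p * spherical_deriv \<Omega> f q)"

text \<open>
  The quotient is completed on the sphere by its limit along a horizontal segment inside the slice of
  the point.
\<close>
definition regular_quotient :: "quat \<Rightarrow> quat" where
  "regular_quotient q = (if q \<in> qsphere (Re w) (Im w)
     then Lim (at_right 0) (\<lambda>t. quotient_off_sphere (q + of_real t)) else quotient_off_sphere q)"

lemma quotient_off_sphere_stem:
  assumes st: "local_stem \<Omega> f z I \<epsilon> b c" and I: "I \<in> imag_units"
  defines "b2 \<equiv> stem_re z (b z) (c z) - q_conj p * b z" and "c2 \<equiv> stem_im z (b z) (c z) - q_conj p * c z"
    and "n \<equiv> inverse ((z - w) * (z - cnj w))"
  shows "quotient_off_sphere (slice_pt z I) = stem_re n b2 c2 + I * stem_im n b2 c2"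
proof -
  let ?q = "slice_pt z I"
  have "?q * f ?q - q_conj p * spherical_value \<Omega> f ?q - q_Im ?q * q_conj p * spherical_deriv \<Omega> f ?q
      = ?q * f ?q - q_conj p * b z - I * (q_conj p * c z)"
  proof (cases "Im z = 0")
    case True
    then show ?thesis
      using local_stem_real[OF st I True] local_stem_center[OF st I] slice_pt_coords(5)[OF I]
      by (simp add: spherical_value_def slice_pt_coords(2)[OF I])
  next
    case False
    then show ?thesis
      by (simp add: local_stem_spherical[OF st I False] slice_pt_coords(2)[OF I] mult.assoc)
  qed
  also have "\<dots> = b2 + I * c2"
    using stem_eval[OF I, of z "b z" "c z"] local_stem_center(2)[OF st I]
    by (simp add: b2_def c2_def algebra_simps)
  finally have num: "?q * f ?q - q_conj p * spherical_value \<Omega> f ?q - q_Im ?q * q_conj p * spherical_deriv \<Omega> f ?q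
      = b2 + I * c2" .
  have "(z - w) * (z - cnj w) = z * z - of_real (2 * Re w) * z + of_real ((cmod w)\<^sup>2)"
    unfolding cmod_power2 by (simp add: complex_eq_iff algebra_simps power2_eq_square)
  moreover have "slice_pt (a - a' + a'') I = slice_pt a I - slice_pt a' I + slice_pt a'' I" for a a' a''
    by (simp add: slice_pt_eq algebra_simps)
  ultimately have "slice_pt ((z - w) * (z - cnj w)) I = ?q\<^sup>2 - (2 * Re w) *\<^sub>R ?q + of_real ((cmod w)\<^sup>2)"
    by (simp only: slice_pt_mult[OF I] flip: of_real_eq_slice_pt)
       (simp add: power2_eq_square scaleR_conv_of_real)
  then have "inverse (?q\<^sup>2 - (2 * Re w) *\<^sub>R ?q + of_real ((cmod w)\<^sup>2)) = slice_pt n I"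
    by (simp only: n_def slice_pt_inverse[OF I])
  then show ?thesis
    unfolding quotient_off_sphere_def num by (simp add: stem_eval[OF I])
qed

text \<open>
  The quotient stems provided locally by \<open>stem_division\<close> are stems of the globally defined function
  \<open>regular_quotient\<close>. On the sphere this is the continuity of the stems along the segment in its
  definition.
\<close>
lemma regular_quotient_local_stem:
  assumes I: "I \<in> imag_units" and a: "slice_pt a I \<in> \<Omega> - \<O>"
  obtains \<delta> B C where "local_stem (\<Omega> - \<O>) regular_quotient a I \<delta> B C"
    "f (slice_pt a I) = (stem_re a (B a) (C a) - p * B a) + I * (stem_im a (B a) (C a) - p * C a)"
proof -
  obtain \<epsilon> b c where st: "local_stem \<Omega> f a I \<epsilon> b c"
    using local_stem_exists[OF \<Omega> f I] a by blast
  then have \<epsilon>: "\<epsilon> > 0" "stem_holo (ball a \<epsilon>) b c" by (simp_all add: local_stem_def)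
  define b2 where "b2 z = stem_re z (b z) (c z) - q_conj p * b z" for z
  define c2 where "c2 z = stem_im z (b z) (c z) - q_conj p * c z" for z
  define n where "n z = inverse ((z - w) * (z - cnj w))" for z
  have root: "Im a *\<^sub>R b a = - (Im w *\<^sub>R (I0 * c a))" if "a \<in> {w, cnj w}"
    using exceptional_iff[OF st I] that a by blast
  have "Im w \<noteq> 0" using w by simp
  obtain \<delta> B C where \<delta>: "0 < \<delta>" "\<delta> \<le> \<epsilon>" and BC: "stem_holo (ball a \<delta>) B C"
    and away: "\<And>z. z \<in> ball a \<delta> \<Longrightarrow> z \<noteq> a \<Longrightarrow> z \<notin> {w, cnj w}"
    and eq: "\<And>z. z \<in> ball a \<delta> \<Longrightarrow> z \<notin> {w, cnj w} \<Longrightarrow>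
       B z = stem_re (n z) (b2 z) (c2 z) \<and> C z = stem_im (n z) (b2 z) (c2 z)"
    and fact: "\<And>z. z \<in> ball a \<delta> \<Longrightarrow> b z = stem_re z (B z) (C z) - p * B z \<and> c z = stem_im z (B z) (C z) - p * C z"
    using stem_division[OF \<epsilon>(2,1) p I0 \<open>Im w \<noteq> 0\<close> root] unfolding b2_def c2_def n_def by blast
  obtain r where r: "r > 0" "\<And>z J. dist a z < r \<Longrightarrow> dist J I < r \<Longrightarrow> slice_pt z J \<in> \<Omega> - \<O>"
    using slice_tube[OF open_Diff_exceptional a] by blast
  have off: "quotient_off_sphere (slice_pt z J) = B z + J * C z"
    if "z \<in> ball a \<delta>" "z \<notin> {w, cnj w}" "J \<in> imag_units" "dist J I < \<delta>" for z J
  proof -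
    have "local_stem \<Omega> f z J (min (\<epsilon> - dist a z) (\<epsilon> - dist J I)) b c"
      using that \<delta> by (intro local_stem_move[OF st]) auto
    from quotient_off_sphere_stem[OF this that(3)] show ?thesis
      using eq[OF that(1,2)] by (simp add: b2_def c2_def n_def)
  qed
  have "regular_quotient (slice_pt z J) = B z + J * C z"
    if z: "z \<in> ball a \<delta>" and J: "J \<in> imag_units" "dist J I < \<delta>" for z J
  proof (cases "z \<in> {w, cnj w}")
    case False
    then show ?thesis
      using off[OF z False J] slice_pt_in_qsphere_iff[OF J(1), of z w] by (simp add: regular_quotient_def)
  next
    case True
    then have za: "z = a" using away z by blast
    define h where "h t = a + of_real t" for t :: real
    have h: "(h \<longlongrightarrow> a) (at_right 0)"
      unfolding h_def by (rule tendsto_eq_intros refl | simp)+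
    have "isCont B a" "isCont C a"
      using stem_holo_continuous_on[OF BC] \<delta>(1) by (simp_all add: continuous_on_eq_continuous_at)
    then have lim: "((\<lambda>t. B (h t) + J * C (h t)) \<longlongrightarrow> B a + J * C a) (at_right 0)"
      by (intro tendsto_intros isCont_tendsto_compose[OF _ h])
    have "eventually (\<lambda>t. h t \<in> ball a \<delta>) (at_right 0)"
      using h \<delta>(1) by (auto dest: topological_tendstoD[of _ _ _ "ball a \<delta>"])
    then have "eventually (\<lambda>t. B (h t) + J * C (h t) = quotient_off_sphere (slice_pt a J + of_real t)) (at_right 0)"
      using eventually_at_right_less[of 0]
    proof eventually_elim
      case (elim t)
      have "slice_pt a J + of_real t = slice_pt (h t) J"
        by (simp add: slice_pt_eq h_def)
      then show ?case
        using off[OF elim(1) away J] elim by (simp add: h_def)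
    qed
    then have "((\<lambda>t. quotient_off_sphere (slice_pt a J + of_real t)) \<longlongrightarrow> B a + J * C a) (at_right 0)"
      using lim tendsto_cong by fast
    then show ?thesis
      using slice_pt_in_qsphere_iff[OF J(1), of z w] True
      by (simp add: regular_quotient_def za tendsto_Lim)
  qed
  then have "local_stem (\<Omega> - \<O>) regular_quotient a I (min \<delta> r) B C"
    unfolding local_stem_def using \<delta> r BC by (auto intro: stem_holo_subset)
  moreover have "f (slice_pt a I) = (stem_re a (B a) (C a) - p * B a) + I * (stem_im a (B a) (C a) - p * C a)"
    using fact[of a] \<delta> local_stem_center(2)[OF st I] by simp
  ultimately show thesis by (rule that)
qed

lemma regular_quotient_slice_regular: "slice_regular (\<Omega> - \<O>) regular_quotient"
proof (rule local_stems_imp_slice_regular[OF open_Diff_exceptional])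
  fix z I assume "I \<in> imag_units" "slice_pt z I \<in> \<Omega> - \<O>"
  then obtain \<delta> B C where "local_stem (\<Omega> - \<O>) regular_quotient z I \<delta> B C"
    by (rule regular_quotient_local_stem)
  then show "\<exists>\<epsilon> b c. local_stem (\<Omega> - \<O>) regular_quotient z I \<epsilon> b c" by blast
qed

lemma regular_prod_regular_quotient:
  assumes "q \<in> \<Omega> - \<O>"
  shows "f q = regular_prod (\<Omega> - \<O>) (\<lambda>q. q - p) regular_quotient q"
proof -
  obtain a I where I: "I \<in> imag_units" and q: "q = slice_pt a I" and "Im a \<ge> 0"
    by (rule slice_pt_exists)
  obtain \<delta> B C where st: "local_stem (\<Omega> - \<O>) regular_quotient a I \<delta> B C"
    and "f (slice_pt a I) = (stem_re a (B a) (C a) - p * B a) + I * (stem_im a (B a) (C a) - p * C a)"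
    using assms regular_quotient_local_stem[OF I, of a] unfolding q by blast
  then show ?thesis
    using regular_prod_linear_factor[OF open_Diff_exceptional st I] by (simp add: q)
qed

text \<open>
  At a point of the sphere of \<open>p\<close> the stem of a multiple of \<open>q - p\<close> takes the value
  \<open>(w - p) (B + \<iota> C)\<close>, which is annihilated by \<open>w - q_conj p\<close>; hence such a point is not exceptional.
\<close>
lemma no_regular_quotient:
  assumes \<Lambda>: "slice_domain \<Lambda>" "\<Lambda> \<subseteq> \<Omega>" and g: "slice_regular \<Lambda> g"
    and prod: "\<And>q. q \<in> \<Lambda> \<Longrightarrow> f q = regular_prod \<Lambda> (\<lambda>q. q - p) g q"
  shows "\<Lambda> \<inter> \<O> = {}"
proof (rule ccontr)
  assume "\<Lambda> \<inter> \<O> \<noteq> {}"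
  then obtain q where q: "q \<in> \<Lambda>" "q \<in> \<O>" by blast
  then obtain I where I: "I \<in> imag_units" "q = slice_pt w I" by (auto simp: qsphere_eq \<O>_def)
  then obtain \<epsilon> B C where G: "local_stem \<Lambda> g w I \<epsilon> B C"
    using local_stem_exists[OF \<Lambda>(1) g I(1)] q by blast
  obtain \<eta> b c where F: "local_stem \<Omega> f w I \<eta> b c"
    using local_stem_exists[OF \<Omega> f I(1)] q I \<Lambda> by blast
  have pos: "\<epsilon> > 0" "\<eta> > 0" using F G by (simp_all add: local_stem_def)
  have "open \<Lambda>" using \<Lambda>(1) by (simp add: slice_domain_def)
  let ?b = "stem_re w (B w) (C w) - p * B w" and ?c = "stem_im w (B w) (C w) - p * C w"
  obtain K where K: "K \<in> imag_units" "K \<noteq> I" "dist K I < min \<epsilon> \<eta>"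
    using imag_units_near[OF I(1), of "min \<epsilon> \<eta>"] pos by auto
  have "b w + J * c w = ?b + J * ?c" if J: "J \<in> imag_units" "dist J I < min \<epsilon> \<eta>" for J
  proof -
    have st: "local_stem \<Lambda> g w J (min (\<epsilon> - dist w w) (\<epsilon> - dist J I)) B C"
      using J pos by (intro local_stem_move[OF G]) auto
    have "b w + J * c w = f (slice_pt w J)"
      using F J pos by (simp add: local_stem_def)
    also have "\<dots> = ?b + J * ?c"
      using prod[OF local_stem_center(1)[OF st J(1)]] regular_prod_linear_factor[OF \<open>open \<Lambda>\<close> st J(1)] by simp
    finally show ?thesis .
  qed
  then have "b w + I * c w = ?b + I * ?c" "b w + K * c w = ?b + K * ?c"
    using I K pos by auto
  then have bc: "b w = ?b" "c w = ?c"
    using two_unit_formula(1,2)[OF I(1) K(1)] K(2) by metis+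
  have "b w = - (I0 * c w)"
    unfolding bc p stem_re_def stem_im_def slice_pt_eq
    by (simp add: algebra_simps of_real_def imag_units_square_assoc[OF I0])
  then have "Im w *\<^sub>R b w = - (Im w *\<^sub>R (I0 * c w))" by simp
  then show False
    using exceptional_iff[OF F I(1)] q I by simp
qed

end

theorem theorem7p2:
  fixes \<Omega> :: "quat set" and f :: "quat \<Rightarrow> quat" and p I\<^sub>0 :: quat and x\<^sub>0 y\<^sub>0 :: real
  assumes "slice_domain \<Omega>" and "slice_regular \<Omega> f"
    and "I\<^sub>0 \<in> imag_units" and "y\<^sub>0 > 0" and "p = of_real x\<^sub>0 + of_real y\<^sub>0 * I\<^sub>0" and "p \<in> \<Omega>"
    and "S = qsphere x\<^sub>0 y\<^sub>0"
    and "\<O> = {q \<in> S \<inter> \<Omega>. spherical_value \<Omega> f q \<noteq> - q_Im p * spherical_deriv \<Omega> f q}"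
  shows "slice_domain (\<Omega> - \<O>) \<and>
    (\<exists>g. slice_regular (\<Omega> - \<O>) g \<and>
         (\<forall>q \<in> \<Omega> - \<O>. f q = regular_prod (\<Omega> - \<O>) (\<lambda>q. q - p) g q)) \<and>
    (\<forall>\<Lambda>. slice_domain \<Lambda> \<and> \<Lambda> \<subseteq> \<Omega> \<and> \<Lambda> \<inter> \<O> \<noteq> {} \<longrightarrow>
         \<not> (\<exists>g. slice_regular \<Lambda> g \<and>
              (\<forall>q \<in> \<Lambda>. f q = regular_prod \<Lambda> (\<lambda>q. q - p) g q)))"
proof -
  define w where "w = Complex x\<^sub>0 y\<^sub>0"
  have w: "Im w > 0" and p: "p = slice_pt w I\<^sub>0"
    using assms(4,5) by (simp_all add: w_def slice_pt_def qpt_def)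
  have \<O>: "\<O> = {q \<in> qsphere (Re w) (Im w) \<inter> \<Omega>. spherical_value \<Omega> f q \<noteq> - q_Im p * spherical_deriv \<Omega> f q}"
    (is "_ = ?O") by (simp add: assms(7,8) w_def)
  note hyps = assms(1,2,3) w p
  show ?thesis
    unfolding \<O>
  proof (intro conjI exI ballI allI impI notI)
    show "slice_domain (\<Omega> - ?O)"
      by (rule slice_domain_Diff_exceptional[OF hyps])
    show "slice_regular (\<Omega> - ?O) (regular_quotient \<Omega> f p w)"
      by (rule regular_quotient_slice_regular[OF hyps])
    show "f q = regular_prod (\<Omega> - ?O) (\<lambda>q. q - p) (regular_quotient \<Omega> f p w) q" if "q \<in> \<Omega> - ?O" for q
      using that by (rule regular_prod_regular_quotient[OF hyps])
    fix \<Lambda>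
    assume \<Lambda>: "slice_domain \<Lambda> \<and> \<Lambda> \<subseteq> \<Omega> \<and> \<Lambda> \<inter> ?O \<noteq> {}"
      and "\<exists>g. slice_regular \<Lambda> g \<and> (\<forall>q\<in>\<Lambda>. f q = regular_prod \<Lambda> (\<lambda>q. q - p) g q)"
    then obtain g where "slice_regular \<Lambda> g" "\<And>q. q \<in> \<Lambda> \<Longrightarrow> f q = regular_prod \<Lambda> (\<lambda>q. q - p) g q"
      by blast
    then have "\<Lambda> \<inter> ?O = {}"
      using no_regular_quotient[OF hyps] \<Lambda> by blast
    then show False using \<Lambda> by blast
  qed
qed

end
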